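(* Let $d>0$, $\beta\ge 0$, $\alpha\ge 1$, let $T>0$ be arbitrary, and let the triangulation $\mathcal K_h$ satisfy the angle condition $\alpha_1+\alpha_2\le\pi$ for every edge. Let $U(\cdot,t)=\sum_{i=1}^N\xi_i(t)\chi_i$, $t\in[0,T]$, be the solution of the semi-discrete problem: $U,\dot U\in L^2([0,T];S_h)$ and $$\int_{\Gamma_h} I_h(\dot U\phi)+d\int_{\Gamma_h}\nabla_{\Gamma_h}U\cdot\nabla_{\Gamma_h}\phi=-\beta\int_{\Gamma_h}I_h(U^\alpha\phi)\qquad\forall\,\phi\in S_h,$$ with nonnegative initial nodal values $\xi_i(0)\ge 0$, $i=1,\dots,N$. Then $$0\le \xi_i(t)\le \max_{j=1,\dots,N}\xi_j(0)\qquad \forall\, i=1,\dots,N,\ \forall\, t\in(0,T].$$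
   Context: $\Gamma\subset\mathbb R^3$ is a compact, orientable, smooth surface without boundary, given as the zero level set of a sufficiently smooth signed distance function $\mathsf d$ defined on an open neighbourhood $W$ of $\Gamma$ with $\nabla\mathsf d\neq 0$ on $W$; its unit normal is $\nu=\nabla \mathsf d/|\nabla\mathsf d|$, and every $x\in W$ is uniquely written as $x=a(x)+\mathsf d(x)\nu(a(x))$ with $a(x)\in\Gamma$. For $h>0$, $\Gamma_h=\bigcup_{K\in\mathcal K_h}K\subset W$ is a closed triangulated surface, where $\mathcal K_h$ is a finite (conforming) set of non-degenerate triangles with diameters at most $h$, whose vertices $x_1,\dots,x_N$ lie on $\Gamma$, and such that $a|_{\Gamma_h}$ is a one-to-one map between $\Gamma_h$ and $\Gamma$. $S_h$ is the space of continuous functions on $\Gamma_h$ that are affine on each $K\in\mathcal K_h$, with nodal basis $\chi_1,\dots,\chi_N$, $\chi_i(x_j)=\delta_{ij}$. For continuous $v$ on $\Gamma_h$, $I_h(v)=\sum_i v(x_i)\chi_i$ is the piecewise linear interpolant. $\nabla_{\Gamma_h}$ is the (trianglewise) tangential gradient. The dot denotes the time derivative. Angle condition: for every edge $e$ of $\mathcal K_h$, if $K_1,K_2$ are the two triangles sharing $e$ and $\alpha_1,\alpha_2$ are the angles of $K_1,K_2$ opposite to $e$, then $\alpha_1+\alpha_2\le\pi$. Equivalently, with $\bar M=(\int_{\Gamma_h}I_h(\chi_i\chi_j))_{ij}$ and $A=(\int_{\Gamma_h}\nabla_{\Gamma_h}\chi_i\cdot\nabla_{\Gamma_h}\chi_j)_{ij}$,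 the semi-discrete problem is the ODE system $\bar M\dot\xi+dA\xi=-\beta\bar M\xi^\alpha$ for $\xi=(\xi_1,\dots,\xi_N)^T$, with $\xi^\alpha$ taken componentwise. *)

theory Defs
  imports "HOL-Analysis.Analysis"
begin

section \<open>The smooth surface\<close>

primrec Ck_on :: "nat \<Rightarrow> ('a::real_normed_vector \<Rightarrow> real) \<Rightarrow> 'a set \<Rightarrow> bool" where
  "Ck_on 0 f W \<longleftrightarrow> continuous_on W f"
| "Ck_on (Suc k) f W \<longleftrightarrow>
     (\<exists>f'. (\<forall>x\<in>W. (f has_derivative f' x) (at x)) \<and> (\<forall>v. Ck_on k (\<lambda>x. f' x v) W))"

definition grad :: "('a::real_inner \<Rightarrow> real) \<Rightarrow> 'a \<Rightarrow> 'a" where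
  "grad f x = (THE g. GDERIV f x :> g)"

definition unit_normal :: "('a::real_inner \<Rightarrow> real) \<Rightarrow> 'a \<Rightarrow> 'a" where
  "unit_normal sd x = grad sd x /\<^sub>R norm (grad sd x)"

text \<open>\<open>sd\<close> is the signed distance function and \<open>a\<close> the closest-point projection. Orientability
  and the absence of a boundary follow from \<open>\<Gamma>\<close> being a regular level set contained in the open
  set \<open>W\<close>.\<close>

locale level_set_surface =
  fixes \<Gamma> W :: "(real^3) set" and sd :: "real^3 \<Rightarrow> real" and a :: "real^3 \<Rightarrow> real^3"
  assumes compact_surface: "compact \<Gamma>"
    and open_nbhd: "open W" and surface_subset: "\<Gamma> \<subseteq> W"
    and zero_level_set: "\<Gamma> = {x \<in> W. sd x = 0}"
    and signed_distance: "\<forall>x\<in>W. \<bar>sd x\<bar> = infdist x \<Gamma>"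
    and smooth: "Ck_on 2 sd W"
    and regular: "\<forall>x\<in>W. grad sd x \<noteq> 0"
    and projection: "\<forall>x\<in>W. a x \<in> \<Gamma> \<and> x = a x + sd x *\<^sub>R unit_normal sd (a x)"
    and projection_unique:
      "\<forall>x\<in>W. \<forall>y\<in>\<Gamma>. x = y + sd x *\<^sub>R unit_normal sd y \<longrightarrow> y = a x"

section \<open>The triangulated surface\<close>

definition vertices :: "'a::euclidean_space set set \<Rightarrow> 'a set" where
  "vertices Kh = {v. \<exists>K\<in>Kh. v extreme_point_of K}"

text \<open>Conformity and finiteness are part of the library notion \<^const>\<open>triangulation\<close>.\<close>

locale triangulated_surface = level_set_surface +
  fixes h :: real and Kh :: "(real^3) set set" and N :: nat and x :: "nat \<Rightarrow> real^3"
  assumes h_pos: "h > 0"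
    and conforming: "triangulation Kh"
    and triangles: "\<forall>K\<in>Kh. 2 simplex K"
    and closed_surface:
      "\<forall>K\<in>Kh. \<forall>e. e edge_of K \<longrightarrow> card {K' \<in> Kh. e edge_of K'} = 2"
    and diameters: "\<forall>K\<in>Kh. diameter K \<le> h"
    and in_nbhd: "\<Union>Kh \<subseteq> W"
    and enum_vertices: "bij_betw x {1..N} (vertices Kh)"
    and vertices_on_surface: "\<forall>i\<in>{1..N}. x i \<in> \<Gamma>"
    and projection_bij: "bij_betw a (\<Union>Kh) \<Gamma>"

text \<open>The angle at the vertex \<open>r\<close> between the directions towards \<open>p\<close> and \<open>q\<close>.\<close>

definition angle_at :: "'a::real_inner \<Rightarrow> 'a \<Rightarrow> 'a \<Rightarrow> real" where
  "angle_at r p q = arccos (((p - r) \<bullet> (q - r)) / (norm (p - r) * norm (q - r)))"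

text \<open>The common edge is the segment from \<open>p\<close> to \<open>q\<close>; the opposite vertices are \<open>r1\<close> and \<open>r2\<close>.\<close>

definition angle_condition :: "'a::real_inner set set \<Rightarrow> bool" where
  "angle_condition Kh \<longleftrightarrow>
     (\<forall>p q r1 r2. convex hull {p, q, r1} \<in> Kh \<and> convex hull {p, q, r2} \<in> Kh \<and>
        convex hull {p, q, r1} \<noteq> convex hull {p, q, r2} \<longrightarrow>
        angle_at r1 p q + angle_at r2 p q \<le> pi)"

section \<open>Finite elements\<close>

text \<open>Functions on \<open>\<Union>Kh\<close> are represented by functions on the ambient space, whose values off
  \<open>\<Union>Kh\<close> play no role.\<close>

definition Sh :: "'a::real_inner set set \<Rightarrow> ('a \<Rightarrow> real) set" where
  "Sh Kh = {f. continuous_on (\<Union>Kh) f \<and> (\<forall>K\<in>Kh. \<exists>g c. \<forall>y\<in>K. f y = g \<bullet> y + c)}"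

definition nodal_basis ::
  "'a::real_inner set set \<Rightarrow> nat \<Rightarrow> (nat \<Rightarrow> 'a) \<Rightarrow> (nat \<Rightarrow> 'a \<Rightarrow> real) \<Rightarrow> bool" where
  "nodal_basis Kh N x \<psi> \<longleftrightarrow>
     (\<forall>i\<in>{1..N}. \<psi> i \<in> Sh Kh \<and> (\<forall>j\<in>{1..N}. \<psi> i (x j) = (if i = j then 1 else 0)))"

definition interpolant ::
  "nat \<Rightarrow> (nat \<Rightarrow> 'a) \<Rightarrow> (nat \<Rightarrow> 'a \<Rightarrow> real) \<Rightarrow> ('a \<Rightarrow> real) \<Rightarrow> 'a \<Rightarrow> real" where
  "interpolant N x \<psi> v = (\<lambda>y. \<Sum>i=1..N. v (x i) * \<psi> i y)"

text \<open>The gradient of \<open>f\<close> along the triangle \<open>K\<close>: the vector in the direction space of \<open>K\<close>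
  that represents the derivative of \<open>f\<close> within \<open>K\<close>.\<close>

definition tangential_gradient :: "'a::real_inner set \<Rightarrow> ('a \<Rightarrow> real) \<Rightarrow> 'a \<Rightarrow> 'a" where
  "tangential_gradient K f y =
     (THE g. g \<in> span {u - v |u v. u \<in> K \<and> v \<in> K} \<and>
             (f has_derivative (\<lambda>w. g \<bullet> w)) (at y within K))"

text \<open>The surface integral over a triangle, through the affine parametrisation over the reference
  triangle; \<^term>\<open>norm (cross3 (q - p) (r - p))\<close> is the (constant) area element.\<close>

definition param_integral :: "real^3 \<Rightarrow> real^3 \<Rightarrow> real^3 \<Rightarrow> (real^3 \<Rightarrow> real) \<Rightarrow> real" where
  "param_integral p q r f =
     norm (cross3 (q - p) (r - p)) *
     (LINT (s, t) : {(s, t). 0 \<le> s \<and> 0 \<le> t \<and> s + t \<le> 1} | lborel.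
        f (p + s *\<^sub>R (q - p) + t *\<^sub>R (r - p)))"

definition triangle_integral :: "(real^3) set \<Rightarrow> (real^3 \<Rightarrow> real) \<Rightarrow> real" where
  "triangle_integral K f =
     (case (SOME (p, q, r). K = convex hull {p, q, r}) of (p, q, r) \<Rightarrow> param_integral p q r f)"

text \<open>The choice of vertices is immaterial: see \<open>triangle_integral_convex_hull\<close> below.\<close>

lemma measurable_shear: "(\<lambda>(s, t). (1 - s - t, t::real)) \<in> borel_measurable (borel :: (real\<times>real) measure)"
  by (intro borel_measurable_continuous_onI) (auto simp: case_prod_unfold intro!: continuous_intros)

lemma distr_shear:
  "distr lborel lborel (\<lambda>(s, t). (1 - s - t, t)) = (lborel :: (real \<times> real) measure)" (is "?L = _")
proof (rule measure_eqI)
  fix A assume "A \<in> sets ?L"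
  then have A[measurable]: "A \<in> sets (borel :: (real\<times>real) measure)" by simp
  have i[measurable]: "indicator A \<in> borel_measurable (borel \<Otimes>\<^sub>M (borel::real measure))"
    by (simp add: borel_prod)
  have "emeasure ?L A = (\<integral>\<^sup>+z. indicator A z \<partial>?L)" by simp
  also have "\<dots> = (\<integral>\<^sup>+z. indicator A ((\<lambda>(s,t). (1 - s - t, t)) z) \<partial>lborel)"
    using measurable_shear by (subst nn_integral_distr) auto
  also have "\<dots> = (\<integral>\<^sup>+z. (\<lambda>(s,t). indicator A (1 - s - t, t)) z \<partial>(lborel \<Otimes>\<^sub>M lborel))"
    by (simp add: lborel_prod case_prod_unfold)
  also have "\<dots> = (\<integral>\<^sup>+t. \<integral>\<^sup>+s. indicator A (1 - s - t, t) \<partial>lborel \<partial>lborel)"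
    by (subst lborel_pair.nn_integral_snd[symmetric]) (auto simp: case_prod_unfold)
  also have "\<dots> = (\<integral>\<^sup>+t. \<integral>\<^sup>+s. indicator A (s, t) \<partial>lborel \<partial>lborel)"
  proof (rule nn_integral_cong)
    fix t :: real
    show "(\<integral>\<^sup>+s. indicator A (1 - s - t, t) \<partial>lborel) = (\<integral>\<^sup>+s. indicator A (s, t) \<partial>lborel)"
      by (subst (2) nn_integral_real_affine[where c = "-1" and t = "1 - t"]) (auto simp: algebra_simps)
  qed
  also have "\<dots> = (\<integral>\<^sup>+z. indicator A z \<partial>(lborel \<Otimes>\<^sub>M lborel))"
    by (subst lborel_pair.nn_integral_snd[symmetric]) (auto simp: case_prod_unfold)
  finally show "emeasure ?L A = emeasure lborel A" by (simp add: lborel_prod)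
qed simp

lemma integral_involution:
  fixes f :: "'a::euclidean_space \<Rightarrow> real"
  assumes g: "g \<in> borel_measurable borel" and d: "distr lborel lborel g = lborel"
    and inv: "\<And>z. g (g z) = z"
  shows "(LINT z|lborel. f (g z)) = (LINT z|lborel. f z)"
proof (cases "f \<in> borel_measurable borel")
  case True
  have "(LINT z|lborel. f z) = (LINT z|distr lborel lborel g. f z)" by (simp add: d)
  also have "\<dots> = (LINT z|lborel. f (g z))"
    using True g by (subst integral_distr) auto
  finally show ?thesis by simp
next
  case False
  have "(\<lambda>z. f (g z)) \<notin> borel_measurable borel"
  proof
    assume "(\<lambda>z. f (g z)) \<in> borel_measurable borel"
    from measurable_compose[OF g this] show False using False by (simp add: inv)
  qed
  then have "\<not> integrable lborel (\<lambda>z. f (g z))" "\<not> integrable lborel f"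
    using False borel_measurable_integrable[of lborel f]
      borel_measurable_integrable[of lborel "\<lambda>z. f (g z)"] by auto
  then show ?thesis by (simp add: not_integrable_integral_eq)
qed

lemma set_integral_involution:
  fixes F G :: "'a::euclidean_space \<Rightarrow> real"
  assumes g: "g \<in> borel_measurable borel" and d: "distr lborel lborel g = lborel"
    and inv: "\<And>z. g (g z) = z"
    and FG: "\<And>z. F z = G (g z)" and R: "\<And>z. g z \<in> R \<longleftrightarrow> z \<in> R"
  shows "(LINT z:R|lborel. F z) = (LINT z:R|lborel. G z)"
  using integral_involution[OF g d inv, of "\<lambda>z. indicat_real R z *\<^sub>R G z"]
  by (simp add: set_lebesgue_integral_def FG R indicator_def)

lemma param_integral_swap: "param_integral p r q f = param_integral p q r f"
proof -
  have "norm (cross3 (r - p) (q - p)) = norm (cross3 (q - p) (r - p))"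
    by (metis cross_skew norm_minus_cancel)
  moreover have "distr lborel lborel (\<lambda>(s, t). (t, s)) = (lborel :: (real \<times> real) measure)"
    by (metis lborel_pair.distr_pair_swap lborel_prod)
  then have "(LINT (s, t) : {(s, t). 0 \<le> s \<and> 0 \<le> t \<and> s + t \<le> 1} | lborel.
        f (p + s *\<^sub>R (r - p) + t *\<^sub>R (q - p))) =
    (LINT (s, t) : {(s, t). 0 \<le> s \<and> 0 \<le> t \<and> s + t \<le> 1} | lborel.
        f (p + s *\<^sub>R (q - p) + t *\<^sub>R (r - p)))"
    by (intro set_integral_involution[where g = "\<lambda>(s, t). (t, s)"] borel_measurable_continuous_onI)
      (auto simp: case_prod_unfold add_ac intro!: continuous_intros)
  ultimately show ?thesis by (simp add: param_integral_def)
qed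

lemma param_integral_swap': "param_integral q p r f = param_integral p q r f"
proof -
  have "cross3 (p - q) (r - q) = - cross3 (q - p) (r - p)"
    by (simp add: cross3_simps)
  then have "norm (cross3 (p - q) (r - q)) = norm (cross3 (q - p) (r - p))" by simp
  moreover have e: "q + s *\<^sub>R (p - q) + t *\<^sub>R (r - q) = p + (1 - s - t) *\<^sub>R (q - p) + t *\<^sub>R (r - p)" for s t
    by (simp add: algebra_simps)
  have "(LINT (s, t) : {(s, t). 0 \<le> s \<and> 0 \<le> t \<and> s + t \<le> 1} | lborel.
        f (q + s *\<^sub>R (p - q) + t *\<^sub>R (r - q))) =
    (LINT (s, t) : {(s, t). 0 \<le> s \<and> 0 \<le> t \<and> s + t \<le> 1} | lborel.
        f (p + s *\<^sub>R (q - p) + t *\<^sub>R (r - p)))"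
    by (rule set_integral_involution[OF measurable_shear distr_shear]) (auto simp: e)
  ultimately show ?thesis by (simp add: param_integral_def)
qed

lemma param_integral_perm:
  assumes "{p, q, r} = {p', q', r'}" "card {p, q, r} = 3"
  shows "param_integral p q r f = param_integral p' q' r' f"
proof -
  have pq: "p \<noteq> q" "p \<noteq> r" "q \<noteq> r" using assms(2) by (auto simp: card_insert_if split: if_splits)
  have d': "p' \<noteq> q'" "p' \<noteq> r'" "q' \<noteq> r'"
    using assms(2) unfolding assms(1) by (auto simp: card_insert_if split: if_splits)
  have "p' \<in> {p, q, r}" "q' \<in> {p, q, r}" "r' \<in> {p, q, r}" using assms(1) by blast+
  then consider "p' = p" "q' = q" "r' = r" | "p' = p" "q' = r" "r' = q" | "p' = q" "q' = p" "r' = r"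
    | "p' = q" "q' = r" "r' = p" | "p' = r" "q' = p" "r' = q" | "p' = r" "q' = q" "r' = p"
    using d' by blast
  then show ?thesis
  proof cases
    case 4
    have "param_integral p q r f = param_integral q p r f" by (rule param_integral_swap')
    also have "\<dots> = param_integral q r p f" by (rule param_integral_swap)
    finally show ?thesis by (simp add: 4)
  next
    case 5
    have "param_integral p q r f = param_integral p r q f" by (rule param_integral_swap)
    also have "\<dots> = param_integral r p q f" by (rule param_integral_swap')
    finally show ?thesis by (simp add: 5)
  next
    case 6
    have "param_integral p q r f = param_integral q p r f" by (rule param_integral_swap')
    also have "\<dots> = param_integral q r p f" by (rule param_integral_swap)
    also have "\<dots> = param_integral r q p f" by (rule param_integral_swap')
    finally show ?thesis by (simp add: 6)
  qed (simp_all add: param_integral_swap[of p r q] param_integral_swap'[of q p r])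
qed

lemma triangle_integral_convex_hull:
  assumes "\<not> collinear {p, q, r}"
  shows "triangle_integral (convex hull {p, q, r}) f = param_integral p q r f"
proof -
  let ?P = "\<lambda>(p', q', r'). convex hull {p, q, r} = convex hull {p', q', r'}"
  obtain p' q' r' where e: "(SOME z. ?P z) = (p', q', r')" by (cases "SOME z. ?P z")
  have "?P (SOME z. ?P z)" by (rule someI[of _ "(p, q, r)"]) simp
  then have hull: "convex hull {p, q, r} = convex hull {p', q', r'}" by (simp add: e)
  have ind: "\<not> affine_dependent {p, q, r}" and c: "card {p, q, r} = 3"
    using assms unfolding collinear_3_eq_affine_dependent by auto
  have "{v. v extreme_point_of (convex hull {p, q, r})} \<subseteq> {p', q', r'}"
    using hull extreme_point_of_convex_hull by fastforce
  then have "{p, q, r} \<subseteq> {p', q', r'}"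
    using extreme_point_of_convex_hull_affine_independent[OF ind] by blast
  moreover have "card {p', q', r'} \<le> 3" by (simp add: card_insert_if)
  ultimately have "{p, q, r} = {p', q', r'}"
    using c by (intro card_seteq) auto
  then show ?thesis
    using e param_integral_perm[OF _ c] by (simp add: triangle_integral_def)
qed
definition surface_integral :: "(real^3) set set \<Rightarrow> (real^3 \<Rightarrow> real) \<Rightarrow> real" where
  "surface_integral Kh f = (\<Sum>K\<in>Kh. triangle_integral K f)"

definition dirichlet_form ::
  "(real^3) set set \<Rightarrow> (real^3 \<Rightarrow> real) \<Rightarrow> (real^3 \<Rightarrow> real) \<Rightarrow> real" where
  "dirichlet_form Kh u v =
     (\<Sum>K\<in>Kh. triangle_integral K
        (\<lambda>y. tangential_gradient K u y \<bullet> tangential_gradient K v y))"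

section \<open>The semi-discrete problem\<close>

text \<open>For a positive integer \<open>\<alpha>\<close> this is the usual power, also of negative numbers. For other
  \<open>\<alpha>\<close> the power of a negative number is the library's \<^term>\<open>u powr \<alpha>\<close>, that is
  \<^term>\<open>\<bar>u\<bar> powr \<alpha>\<close>.\<close>

definition real_power :: "real \<Rightarrow> real \<Rightarrow> real" where
  "real_power u \<alpha> = (if \<alpha> \<in> \<nat> then u ^ nat \<lfloor>\<alpha>\<rfloor> else u powr \<alpha>)"

text \<open>Since \<^term>\<open>Sh Kh\<close> is finite-dimensional, square integrability of a function with values in
  it can be expressed through its point values.\<close>

definition L2_Sh :: "(real^3) set set \<Rightarrow> real \<Rightarrow> (real \<Rightarrow> real^3 \<Rightarrow> real) \<Rightarrow> bool" where
  "L2_Sh Kh T V \<longleftrightarrow>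
     (\<forall>t\<in>{0..T}. V t \<in> Sh Kh) \<and>
     (\<forall>y\<in>\<Union>Kh. (\<lambda>t. V t y) \<in> borel_measurable (lebesgue_on {0..T}) \<and>
                integrable (lebesgue_on {0..T}) (\<lambda>t. (V t y)\<^sup>2))"

text \<open>\<open>U'\<close> is the (weak) time derivative of \<open>U\<close>, where \<open>U\<close> is the representative that is
  continuous in time.\<close>

definition time_derivative ::
  "(real^3) set set \<Rightarrow> real \<Rightarrow> (real \<Rightarrow> real^3 \<Rightarrow> real) \<Rightarrow> (real \<Rightarrow> real^3 \<Rightarrow> real) \<Rightarrow> bool" where
  "time_derivative Kh T U U' \<longleftrightarrow>
     (\<forall>y\<in>\<Union>Kh. \<forall>t\<in>{0..T}. U t y = U 0 y + (LINT s|lebesgue_on {0..t}. U' s y))"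

definition semi_discrete_solution ::
  "(real^3) set set \<Rightarrow> nat \<Rightarrow> (nat \<Rightarrow> real^3) \<Rightarrow> (nat \<Rightarrow> real^3 \<Rightarrow> real) \<Rightarrow>
   real \<Rightarrow> real \<Rightarrow> real \<Rightarrow> real \<Rightarrow> (real \<Rightarrow> real^3 \<Rightarrow> real) \<Rightarrow> bool" where
  "semi_discrete_solution Kh N x \<psi> d \<beta> \<alpha> T U \<longleftrightarrow>
     (\<exists>U'. L2_Sh Kh T U \<and> L2_Sh Kh T U' \<and> time_derivative Kh T U U' \<and>
        (AE t in lebesgue_on {0..T}. \<forall>\<phi>\<in>Sh Kh.
           surface_integral Kh (interpolant N x \<psi> (\<lambda>y. U' t y * \<phi> y))
             + d * dirichlet_form Kh (U t) \<phi>
           = - \<beta> * surface_integral Kh (interpolant N x \<psi> (\<lambda>y. real_power (U t y) \<alpha> * \<phi> y))))"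

end

theory Submission
  imports Defs
begin

text \<open>Testing the weak equation with the hat function of the vertex \<open>i\<close> gives, because of mass
  lumping, the scalar equations

    \<open>m i * \<xi>' i + d * (\<Sum>j. A i j * \<xi> j) = - \<beta> * m i * (\<xi> i) ^ \<alpha>\<close>

  with positive masses \<open>m i\<close>. The right-hand side of the equation solved for \<open>\<xi>'\<close> is continuous in
  time, so the equations hold at every time and the nodal values are continuously differentiable
  (\<open>nodal_values_solve_ode\<close>).

  The stiffness matrix \<open>A\<close> has three properties. It is positive semidefinite, being a Dirichlet form
  (\<open>stiffness_psd\<close>). Its rows sum to zero, since the hat functions sum to 1 (\<open>stiffness_row_sum\<close>). Its
  entries off the diagonal are nonpositive (\<open>stiffness_off_diagonal\<close>): for an edge with opposite angles
  \<open>\<theta>1\<close>, \<open>\<theta>2\<close> the entry is \<open>- (cot \<theta>1 + cot \<theta>2) / 2\<close> (\<open>hat_gradients_cot\<close> for a single triangle),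
  and \<open>cot \<theta>1 + cot \<theta>2 = sin (\<theta>1 + \<theta>2) / (sin \<theta>1 * sin \<theta>2)\<close> is nonnegative when \<open>\<theta>1 + \<theta>2 \<le> pi\<close>.

  These properties yield a discrete maximum principle (\<open>reaction_diffusion_system_bounds\<close>), proved by
  truncation. Let \<open>w i\<close> be the negative part of \<open>\<xi> i\<close>, or the positive part of \<open>\<xi> i - M\<close> with \<open>M\<close> the
  largest initial value. The energy \<open>\<Sum>i. m i * (w i)\<^sup>2\<close> vanishes initially. In its time derivative the
  diffusion has a favourable sign, by splitting into positive and negative parts
  (\<open>positive_part_form_nonneg\<close>), while the reaction acts downwards where \<open>\<xi> i > M\<close>, and where
  \<open>\<xi> i < 0\<close> it contributes at most a multiple of the energy, since \<open>u ^ \<alpha>\<close> is at most linear in \<open>u\<close>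
  on bounded sets. By Gronwall's inequality the energy stays zero.\<close>

section \<open>Truncated energies\<close>

text \<open>Multiplying by the integrating factor \<open>exp (- L * t)\<close> turns the inequality into monotonicity.\<close>

lemma gronwall_zero:
  fixes V V' :: "real \<Rightarrow> real"
  assumes der: "\<And>t. t \<in> {0..T} \<Longrightarrow> (V has_real_derivative V' t) (at t within {0..T})"
    and le: "\<And>t. t \<in> {0..T} \<Longrightarrow> V' t \<le> L * V t"
    and init: "V 0 \<le> 0" and t: "t \<in> {0..T}"
  shows "V t \<le> 0"
proof -
  define g where "g s = exp (- L * s) * V s" for s
  have g: "(g has_real_derivative exp (- L * s) * (V' s - L * V s)) (at s within {0..T})"
    if "s \<in> {0..T}" for s
    unfolding g_def by (auto intro!: derivative_eq_intros der[OF that] simp: algebra_simps)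
  have "g t \<le> g 0"
  proof (rule DERIV_nonpos_imp_decreasing_open[where f = g])
    fix s assume s: "0 < s" "s < t"
    then have "s \<in> {0..T}" "at s within {0..T} = at s"
      using t by (auto intro!: at_within_Icc_at)
    with g[of s] le[of s] show "\<exists>y. DERIV g s :> y \<and> y \<le> 0"
      by (auto intro!: exI mult_nonneg_nonpos)
  qed (use t in \<open>auto intro!: DERIV_continuous_on[OF DERIV_subset[OF g]]\<close>)
  also have "g 0 \<le> 0" using init by (simp add: g_def)
  finally show ?thesis by (simp add: g_def mult_le_0_iff)
qed

text \<open>Squaring removes the kink of the positive part at zero.\<close>

lemma has_real_derivative_max_sq:
  fixes x :: real
  shows "((\<lambda>u. (max u 0)\<^sup>2) has_real_derivative 2 * max x 0) (at x)"
proof -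
  have quad: "\<bar>(max y 0)\<^sup>2 - (max x 0)\<^sup>2 - 2 * max x 0 * (y - x)\<bar> \<le> (y - x)\<^sup>2" for y
  proof (cases "y \<ge> 0"; cases "x \<ge> 0")
    assume "y \<ge> 0" "\<not> x \<ge> 0"
    then have "y\<^sup>2 \<le> (y - x)\<^sup>2" by (intro power_mono) auto
    then show ?thesis using \<open>y \<ge> 0\<close> \<open>\<not> x \<ge> 0\<close> by simp
  next
    assume "\<not> y \<ge> 0" "x \<ge> 0"
    then have "(max y 0)\<^sup>2 - (max x 0)\<^sup>2 - 2 * max x 0 * (y - x) = x\<^sup>2 - 2 * (x * y)"
      by (simp add: power2_eq_square algebra_simps)
    moreover have "x * y \<le> 0" using \<open>\<not> y \<ge> 0\<close> \<open>x \<ge> 0\<close> by (intro mult_nonneg_nonpos) auto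
    moreover have "(y - x)\<^sup>2 = y\<^sup>2 + x\<^sup>2 - 2 * (x * y)" by (simp add: power2_diff)
    ultimately show ?thesis
      using zero_le_power2[of x] zero_le_power2[of y] by linarith
  next
    assume "y \<ge> 0" "x \<ge> 0"
    then have "(max y 0)\<^sup>2 - (max x 0)\<^sup>2 - 2 * max x 0 * (y - x) = (y - x)\<^sup>2"
      by (simp add: power2_eq_square algebra_simps)
    then show ?thesis by simp
  qed simp
  have "((\<lambda>y. ((max y 0)\<^sup>2 - (max x 0)\<^sup>2) / (y - x) - 2 * max x 0) \<longlongrightarrow> 0) (at x)"
  proof (rule Lim_null_comparison)
    show "((\<lambda>y. \<bar>y - x\<bar>) \<longlongrightarrow> 0) (at x)"
      by (auto intro!: tendsto_eq_intros)
    have "\<bar>((max y 0)\<^sup>2 - (max x 0)\<^sup>2) / (y - x) - 2 * max x 0\<bar> \<le> \<bar>y - x\<bar>" if "y \<noteq> x" for y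
    proof -
      have "((max y 0)\<^sup>2 - (max x 0)\<^sup>2) / (y - x) - 2 * max x 0
        = ((max y 0)\<^sup>2 - (max x 0)\<^sup>2 - 2 * max x 0 * (y - x)) / (y - x)"
        using that by (simp add: diff_divide_distrib)
      also have "\<bar>\<dots>\<bar> \<le> (y - x)\<^sup>2 / \<bar>y - x\<bar>"
        using quad[of y] by (simp add: abs_divide divide_right_mono)
      also have "\<dots> = \<bar>y - x\<bar>" using that
        by (subst power2_abs[symmetric]) (simp add: power2_eq_square del: abs_mult_self_eq)
      finally show ?thesis .
    qed
    then show "\<forall>\<^sub>F y in at x. norm (((max y 0)\<^sup>2 - (max x 0)\<^sup>2) / (y - x) - 2 * max x 0) \<le> \<bar>y - x\<bar>"
      by (auto simp: eventually_at_filter)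
  qed
  then show ?thesis by (simp add: has_field_derivative_iff LIM_zero_iff)
qed

text \<open>Testing a system with the positive parts of its unknowns: the energy of the positive parts
  starts at zero and grows at most exponentially, so it never becomes positive.\<close>

lemma positive_parts_vanish:
  fixes \<zeta> D :: "'i \<Rightarrow> real \<Rightarrow> real" and m :: "'i \<Rightarrow> real"
  assumes fin: "finite I" and m: "\<And>i. i \<in> I \<Longrightarrow> m i > 0"
    and der: "\<And>i t. i \<in> I \<Longrightarrow> t \<in> {0..T} \<Longrightarrow> (\<zeta> i has_real_derivative D i t) (at t within {0..T})"
    and le: "\<And>t. t \<in> {0..T} \<Longrightarrow>
      (\<Sum>i\<in>I. m i * max (\<zeta> i t) 0 * D i t) \<le> L * (\<Sum>i\<in>I. m i * (max (\<zeta> i t) 0)\<^sup>2)"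
    and init: "\<And>i. i \<in> I \<Longrightarrow> \<zeta> i 0 \<le> 0"
    and i: "i \<in> I" and t: "t \<in> {0..T}"
  shows "\<zeta> i t \<le> 0"
proof -
  define V where "V s = (\<Sum>i\<in>I. m i * (max (\<zeta> i s) 0)\<^sup>2)" for s
  have "(V has_real_derivative (\<Sum>i\<in>I. m i * (2 * max (\<zeta> i s) 0 * D i s))) (at s within {0..T})"
    if "s \<in> {0..T}" for s
    unfolding V_def
    by (intro DERIV_sum DERIV_cmult DERIV_chain2[OF has_real_derivative_max_sq] der that)
  moreover have "(\<Sum>i\<in>I. m i * (2 * max (\<zeta> i s) 0 * D i s)) \<le> (2 * L) * V s"
    if "s \<in> {0..T}" for s
  proof -
    have "(\<Sum>i\<in>I. m i * (2 * max (\<zeta> i s) 0 * D i s)) = 2 * (\<Sum>i\<in>I. m i * max (\<zeta> i s) 0 * D i s)"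
      by (simp add: sum_distrib_left mult_ac)
    then show ?thesis using le[OF that] by (simp add: V_def)
  qed
  moreover have "V 0 \<le> 0"
    using init by (auto simp: V_def max_def intro!: sum_nonpos)
  ultimately have "V t \<le> 0"
    using t by (rule gronwall_zero)
  moreover have "V t \<ge> m i * (max (\<zeta> i t) 0)\<^sup>2"
    unfolding V_def using fin i m
    by (intro member_le_sum) (auto intro!: mult_nonneg_nonneg less_imp_le[OF m])
  ultimately have "m i * (max (\<zeta> i t) 0)\<^sup>2 \<le> 0" by linarith
  then show ?thesis using m[OF i] by (simp add: mult_le_0_iff split: if_splits)
qed

text \<open>Splitting \<open>\<zeta>\<close> into positive part \<open>w\<close> and negative part, the products of \<open>w\<close> with the negative
  part meet only entries off the diagonal.\<close>

lemma positive_part_form_nonneg: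
  fixes A :: "'i \<Rightarrow> 'i \<Rightarrow> real"
  assumes off: "\<And>i j. i \<in> I \<Longrightarrow> j \<in> I \<Longrightarrow> i \<noteq> j \<Longrightarrow> A i j \<le> 0"
    and psd: "\<And>w. (\<Sum>i\<in>I. \<Sum>j\<in>I. w i * A i j * w j) \<ge> 0"
  shows "(\<Sum>i\<in>I. max (\<zeta> i) 0 * (\<Sum>j\<in>I. A i j * \<zeta> j)) \<ge> 0"
proof -
  let ?w = "\<lambda>i. max (\<zeta> i) 0"
  have "?w i * A i j * ?w j \<le> ?w i * (A i j * \<zeta> j)" if "i \<in> I" "j \<in> I" for i j
  proof (cases "i = j \<or> \<zeta> j \<ge> 0")
    case True
    then show ?thesis by (auto simp: max_def)
  next
    case False
    then have "0 \<le> A i j * \<zeta> j" using off[OF that] by (intro mult_nonpos_nonpos) auto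
    then show ?thesis using False by (simp add: max_def)
  qed
  then have "(\<Sum>i\<in>I. \<Sum>j\<in>I. ?w i * A i j * ?w j) \<le> (\<Sum>i\<in>I. \<Sum>j\<in>I. ?w i * (A i j * \<zeta> j))"
    by (intro sum_mono)
  then show ?thesis using psd[of ?w] by (simp add: sum_distrib_left)
qed

section \<open>The reaction term\<close>

lemma abs_base_powr: "\<bar>u\<bar> powr \<alpha> = u powr \<alpha>" for u :: real
  by (cases "u \<ge> 0") (auto simp: uminus_powr_eq)

lemma abs_real_power:
  assumes "\<alpha> \<ge> 1"
  shows "\<bar>real_power u \<alpha>\<bar> = \<bar>u\<bar> powr \<alpha>"
proof (cases "\<alpha> \<in> \<nat>")
  case True
  then obtain n where n: "\<alpha> = real n" by (auto elim: Nats_cases)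
  with assms have "n \<noteq> 0" by auto
  then have "\<bar>u\<bar> powr real n = \<bar>u\<bar> ^ n"
    by (cases "u = 0") (auto simp: powr_realpow)
  then show ?thesis by (simp add: real_power_def n power_abs)
next
  case False
  then show ?thesis by (simp add: real_power_def abs_base_powr)
qed

lemma real_power_nonneg: "u \<ge> 0 \<Longrightarrow> real_power u \<alpha> \<ge> 0"
  by (simp add: real_power_def)

lemma continuous_on_real_power:
  assumes "\<alpha> \<ge> 1"
  shows "continuous_on UNIV (\<lambda>u. real_power u \<alpha>)"
proof (cases "\<alpha> \<in> \<nat>")
  case True
  then show ?thesis by (simp add: real_power_def continuous_intros)
next
  case False
  have "continuous_on UNIV (\<lambda>u::real. \<bar>u\<bar> powr \<alpha>)"
    using assms by (intro continuous_on_powr' continuous_intros) auto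
  with False show ?thesis by (simp add: real_power_def abs_base_powr)
qed

text \<open>This is what \<open>\<alpha> \<ge> 1\<close> provides: on bounded sets the reaction is at most linear, so that it
  cannot push a vanishing negative part away from zero.\<close>

lemma real_power_linear_bound:
  assumes "\<alpha> \<ge> 1" "\<bar>u\<bar> \<le> R"
  shows "\<bar>real_power u \<alpha>\<bar> \<le> R powr (\<alpha> - 1) * \<bar>u\<bar>"
proof -
  have "\<bar>real_power u \<alpha>\<bar> = \<bar>u\<bar> * \<bar>u\<bar> powr (\<alpha> - 1)"
    using abs_real_power[OF assms(1)] by (simp add: powr_mult_base)
  also have "\<dots> \<le> \<bar>u\<bar> * R powr (\<alpha> - 1)"
    using assms by (intro mult_left_mono powr_mono2) auto
  finally show ?thesis by (simp add: mult.commute)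
qed

section \<open>Maximum principle for the system of ordinary differential equations\<close>

text \<open>For the lower bound the system is tested with the negative parts of \<open>\<xi>\<close>, for the upper bound
  with the positive parts of \<open>\<xi> - M\<close>. The diffusion term has the right sign in both cases; in the
  second one because the vanishing row sums allow \<open>\<xi>\<close> to be replaced by \<open>\<xi> - M\<close> in it. The reaction
  is harmless where \<open>\<xi> > M \<ge> 0\<close>. Where \<open>\<xi> < 0\<close> its sign depends on \<open>\<alpha>\<close>, and its size is
  absorbed by the exponential growth allowed to the energy.\<close>

lemma reaction_diffusion_system_bounds:
  fixes \<xi> D :: "'i \<Rightarrow> real \<Rightarrow> real" and m :: "'i \<Rightarrow> real" and A :: "'i \<Rightarrow> 'i \<Rightarrow> real"
  assumes fin: "finite I" and m: "\<And>i. i \<in> I \<Longrightarrow> m i > 0"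
    and off: "\<And>i j. i \<in> I \<Longrightarrow> j \<in> I \<Longrightarrow> i \<noteq> j \<Longrightarrow> A i j \<le> 0"
    and rows: "\<And>i. i \<in> I \<Longrightarrow> (\<Sum>j\<in>I. A i j) = 0"
    and psd: "\<And>w. (\<Sum>i\<in>I. \<Sum>j\<in>I. w i * A i j * w j) \<ge> 0"
    and d: "d \<ge> 0" and \<beta>: "\<beta> \<ge> 0" and \<alpha>: "\<alpha> \<ge> 1"
    and der: "\<And>i t. i \<in> I \<Longrightarrow> t \<in> {0..T} \<Longrightarrow> (\<xi> i has_real_derivative D i t) (at t within {0..T})"
    and ode: "\<And>i t. i \<in> I \<Longrightarrow> t \<in> {0..T} \<Longrightarrow>
      m i * D i t + d * (\<Sum>j\<in>I. A i j * \<xi> j t) = - \<beta> * (m i * real_power (\<xi> i t) \<alpha>)"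
    and init: "\<And>i. i \<in> I \<Longrightarrow> 0 \<le> \<xi> i 0" "\<And>i. i \<in> I \<Longrightarrow> \<xi> i 0 \<le> M"
    and i: "i \<in> I" and t: "t \<in> {0..T}"
  shows "0 \<le> \<xi> i t \<and> \<xi> i t \<le> M"
proof
  have "\<exists>R. \<forall>t\<in>{0..T}. \<bar>\<xi> i t\<bar> \<le> R" if "i \<in> I" for i
  proof -
    have "continuous_on {0..T} (\<xi> i)" using der[OF that] by (rule DERIV_continuous_on)
    then have "bounded (\<xi> i ` {0..T})"
      by (intro compact_imp_bounded compact_continuous_image) auto
    then show ?thesis by (auto simp: bounded_iff)
  qed
  then obtain R where R: "\<And>i t. i \<in> I \<Longrightarrow> t \<in> {0..T} \<Longrightarrow> \<bar>\<xi> i t\<bar> \<le> R i" by metis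
  \<comment> \<open>the sum serves as one constant for all components\<close>
  define L where "L = \<beta> * (\<Sum>i\<in>I. R i powr (\<alpha> - 1))"
  have L: "\<beta> * \<bar>real_power (\<xi> i t) \<alpha>\<bar> \<le> L * \<bar>\<xi> i t\<bar>" if "i \<in> I" "t \<in> {0..T}" for i t
  proof -
    have "\<bar>real_power (\<xi> i t) \<alpha>\<bar> \<le> R i powr (\<alpha> - 1) * \<bar>\<xi> i t\<bar>"
      using real_power_linear_bound \<alpha> R that by blast
    also have "\<dots> \<le> (\<Sum>i\<in>I. R i powr (\<alpha> - 1)) * \<bar>\<xi> i t\<bar>"
      using fin that by (intro mult_right_mono member_le_sum) auto
    finally show ?thesis using \<beta> by (auto simp: L_def mult.assoc intro: mult_left_mono)
  qed
  have "- \<xi> i t \<le> 0"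
  proof (rule positive_parts_vanish[where D = "\<lambda>i t. - D i t" and L = L, OF fin m _ _ _ i t])
    fix t assume t: "t \<in> {0..T}"
    let ?w = "\<lambda>i. max (- \<xi> i t) 0"
    have "m i * ?w i * - D i t \<le> L * (m i * (?w i)\<^sup>2) - d * (?w i * (\<Sum>j\<in>I. A i j * - \<xi> j t))"
      if i: "i \<in> I" for i
    proof -
      have "?w i * (m i * (\<beta> * real_power (\<xi> i t) \<alpha>)) \<le> ?w i * (m i * (L * ?w i))"
      proof (cases "\<xi> i t \<ge> 0")
        case False
        then have "\<beta> * real_power (\<xi> i t) \<alpha> \<le> L * ?w i"
          using L[OF i t] mult_left_mono[OF abs_ge_self \<beta>, of "real_power (\<xi> i t) \<alpha>"] by simp
        then show ?thesis using m[OF i] by (intro mult_left_mono) auto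
      qed simp
      moreover have "m i * ?w i * - D i t
          = ?w i * (m i * (\<beta> * real_power (\<xi> i t) \<alpha>)) + d * (?w i * (\<Sum>j\<in>I. A i j * \<xi> j t))"
      proof -
        have "m i * - D i t = \<beta> * (m i * real_power (\<xi> i t) \<alpha>) + d * (\<Sum>j\<in>I. A i j * \<xi> j t)"
          using ode[OF i t] by simp
        then have "?w i * (m i * - D i t)
          = ?w i * (\<beta> * (m i * real_power (\<xi> i t) \<alpha>) + d * (\<Sum>j\<in>I. A i j * \<xi> j t))" by simp
        then show ?thesis by (simp only: algebra_simps)
      qed
      ultimately show ?thesis by (simp add: sum_negf power2_eq_square algebra_simps)
    qed
    then have "(\<Sum>i\<in>I. m i * ?w i * - D i t)
      \<le> (\<Sum>i\<in>I. L * (m i * (?w i)\<^sup>2) - d * (?w i * (\<Sum>j\<in>I. A i j * - \<xi> j t)))"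
      by (intro sum_mono)
    also have "\<dots> = L * (\<Sum>i\<in>I. m i * (?w i)\<^sup>2) - d * (\<Sum>i\<in>I. ?w i * (\<Sum>j\<in>I. A i j * - \<xi> j t))"
      by (simp only: sum_subtractf sum_distrib_left)
    also have "\<dots> \<le> L * (\<Sum>i\<in>I. m i * (?w i)\<^sup>2)"
      using mult_nonneg_nonneg[OF d positive_part_form_nonneg[OF off psd, of "\<lambda>i. - \<xi> i t"]] by simp
    finally show "(\<Sum>i\<in>I. m i * ?w i * - D i t) \<le> L * (\<Sum>i\<in>I. m i * (?w i)\<^sup>2)" .
  qed (use DERIV_minus[OF der] init in auto)
  then show "0 \<le> \<xi> i t" by simp
  have "\<xi> i t - M \<le> 0"
  proof (rule positive_parts_vanish[where D = D and L = 0, OF fin m _ _ _ i t])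
    fix t assume t: "t \<in> {0..T}"
    let ?w = "\<lambda>i. max (\<xi> i t - M) 0"
    have "m i * ?w i * D i t \<le> - d * (?w i * (\<Sum>j\<in>I. A i j * (\<xi> j t - M)))"
      if i: "i \<in> I" for i
    proof -
      have "0 \<le> M" using init[OF i] by linarith
      then have "0 \<le> ?w i * (m i * (\<beta> * real_power (\<xi> i t) \<alpha>))"
        using m[OF i] \<beta> real_power_nonneg[of "\<xi> i t" \<alpha>]
        by (cases "\<xi> i t \<le> M") (auto simp: max_def)
      moreover have "(\<Sum>j\<in>I. A i j * (\<xi> j t - M)) = (\<Sum>j\<in>I. A i j * \<xi> j t)"
        using rows[OF i] by (simp add: right_diff_distrib sum_subtractf flip: sum_distrib_right)
      moreover have "?w i * (m i * D i t)
          = ?w i * (- \<beta> * (m i * real_power (\<xi> i t) \<alpha>) - d * (\<Sum>j\<in>I. A i j * \<xi> j t))"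
        using ode[OF i t] by simp
      ultimately show ?thesis by (simp only: algebra_simps)
    qed
    then have "(\<Sum>i\<in>I. m i * ?w i * D i t)
      \<le> (\<Sum>i\<in>I. - d * (?w i * (\<Sum>j\<in>I. A i j * (\<xi> j t - M))))"
      by (intro sum_mono)
    also have "\<dots> = - d * (\<Sum>i\<in>I. ?w i * (\<Sum>j\<in>I. A i j * (\<xi> j t - M)))"
      by (simp only: sum_distrib_left)
    also have "\<dots> \<le> 0"
      using mult_nonneg_nonneg[OF d positive_part_form_nonneg[OF off psd, of "\<lambda>i. \<xi> i t - M"]] by simp
    finally show "(\<Sum>i\<in>I. m i * ?w i * D i t) \<le> 0 * (\<Sum>i\<in>I. m i * (?w i)\<^sup>2)" by simp
  qed (use DERIV_diff[OF der DERIV_const] init in auto)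
  then show "\<xi> i t \<le> M" by simp
qed

section \<open>Regularity in time\<close>

text \<open>On a bounded interval a square integrable function is integrable, and indefinite integrals of
  integrable functions are continuous.\<close>

lemma continuous_on_of_L2_derivative:
  fixes u u' :: "real \<Rightarrow> real"
  assumes meas: "u' \<in> borel_measurable (lebesgue_on {0..T})"
    and L2: "integrable (lebesgue_on {0..T}) (\<lambda>t. (u' t)\<^sup>2)"
    and u: "\<And>t. t \<in> {0..T} \<Longrightarrow> u t = u 0 + (LINT s|lebesgue_on {0..t}. u' s)"
  shows "continuous_on {0..T} u"
proof -
  have one: "integrable (lebesgue_on {0..T}) (\<lambda>t. 1 :: real)"
    by (intro absolutely_integrable_imp_integrable) auto
  have int: "integrable (lebesgue_on {0..T}) u'"
  proof (rule Bochner_Integration.integrable_bound[OF Bochner_Integration.integrable_add[OF one L2] meas])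
    have "\<bar>z\<bar> \<le> 1 + z\<^sup>2" for z :: real
      using zero_le_power2[of "\<bar>z\<bar> - 1"] by (simp add: power2_diff)
    then show "AE t in lebesgue_on {0..T}. norm (u' t) \<le> norm (1 + (u' t)\<^sup>2)" by simp
  qed
  have "continuous_on {0..T} (\<lambda>t. u 0 + integral {0..t} u')"
    using int by (intro continuous_intros indefinite_integral_continuous_1 integrable_on_lebesgue_on) auto
  moreover have "u t = u 0 + integral {0..t} u'" if "t \<in> {0..T}" for t
    using u[OF that] lebesgue_integral_eq_integral[OF integrable_subinterval[OF int, of 0 t]] that
    by auto
  ultimately show ?thesis by (rule continuous_on_eq[OF _ sym])
qed

text \<open>An equation that holds almost everywhere and has a continuous right-hand side holds everywhere, in
  the classical sense: the integral does not see the exceptional set, and the fundamental theorem of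
  calculus applies to the continuous integrand.\<close>

lemma has_real_derivative_of_AE_derivative:
  fixes u u' g :: "real \<Rightarrow> real"
  assumes meas: "u' \<in> borel_measurable (lebesgue_on {0..T})"
    and g: "continuous_on {0..T} g"
    and ae: "AE s in lebesgue_on {0..T}. u' s = g s"
    and u: "\<And>t. t \<in> {0..T} \<Longrightarrow> u t = u 0 + (LINT s|lebesgue_on {0..t}. u' s)"
    and t: "t \<in> {0..T}"
  shows "(u has_real_derivative g t) (at t within {0..T})"
proof -
  have eq: "u t = u 0 + integral {0..t} g" if t: "t \<in> {0..T}" for t
  proof -
    have sub: "{0..t} \<subseteq> {0..T}" using t by auto
    have gi: "integrable (lebesgue_on {0..t}) g"
      by (intro absolutely_integrable_imp_integrable absolutely_integrable_continuous_real
          continuous_on_subset[OF g sub]) auto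
    have "AE s in lebesgue_on {0..t}. u' s = g s"
      using ae sub by (auto simp: AE_restrict_space_iff elim!: eventually_mono)
    then have "(LINT s|lebesgue_on {0..t}. u' s) = (LINT s|lebesgue_on {0..t}. g s)"
      using gi by (intro integral_cong_AE measurable_restrict_mono[OF meas sub]) auto
    with u[OF t] gi show ?thesis by (simp add: lebesgue_integral_eq_integral)
  qed
  have "((\<lambda>t. u 0 + integral {0..t} g) has_real_derivative g t) (at t within {0..T})"
    using DERIV_add[OF DERIV_const integral_has_real_derivative[OF g t]] by simp
  from this zero_less_one t show ?thesis
    by (rule has_field_derivative_transform_within) (rule eq[symmetric])
qed

section \<open>Integrals over triangles\<close>

definition reference_triangle :: "(real \<times> real) set" where
  "reference_triangle = {(s, t). 0 \<le> s \<and> 0 \<le> t \<and> s + t \<le> 1}"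

lemma param_integral_eq:
  "param_integral p q r f = norm (cross3 (q - p) (r - p)) *
     (LINT z : reference_triangle | lborel. f (p + fst z *\<^sub>R (q - p) + snd z *\<^sub>R (r - p)))"
  by (simp add: param_integral_def reference_triangle_def case_prod_unfold)

lemma barycentric_in_triangle:
  assumes "z \<in> reference_triangle"
  shows "p + fst z *\<^sub>R (q - p) + snd z *\<^sub>R (r - p) \<in> convex hull {p, q, r}"
proof -
  have "p + fst z *\<^sub>R (q - p) + snd z *\<^sub>R (r - p)
      = (1 - fst z - snd z) *\<^sub>R p + fst z *\<^sub>R q + snd z *\<^sub>R r"
    by (simp add: algebra_simps)
  then show ?thesis
    using assms unfolding convex_hull_3 reference_triangle_def
    by (intro CollectI exI[of _ "1 - fst z - snd z"] exI[of _ "fst z"] exI[of _ "snd z"]) auto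
qed

lemma compact_reference_triangle: "compact reference_triangle"
proof -
  have "closed {z :: real \<times> real. 0 \<le> fst z \<and> 0 \<le> snd z \<and> fst z + snd z \<le> 1}"
    by (intro closed_Collect_conj closed_Collect_le continuous_intros)
  moreover have "reference_triangle \<subseteq> cbox (0, 0) (1, 1)"
    by (auto simp: reference_triangle_def cbox_Pair_eq)
  then have "bounded reference_triangle" using bounded_cbox bounded_subset by blast
  ultimately show ?thesis
    by (simp add: compact_eq_bounded_closed reference_triangle_def case_prod_unfold)
qed

lemma param_integral_cong:
  assumes "\<And>y. y \<in> convex hull {p, q, r} \<Longrightarrow> f y = g y"
  shows "param_integral p q r f = param_integral p q r g"
proof -
  have "indicat_real reference_triangle z *\<^sub>R f (p + fst z *\<^sub>R (q - p) + snd z *\<^sub>R (r - p))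
     = indicat_real reference_triangle z *\<^sub>R g (p + fst z *\<^sub>R (q - p) + snd z *\<^sub>R (r - p))" for z
    using assms[OF barycentric_in_triangle] by (simp add: indicator_def)
  then show ?thesis unfolding param_integral_eq set_lebesgue_integral_def by presburger
qed

lemma triangle_integral_cong:
  assumes K: "K = convex hull {p, q, r}" and eq: "\<And>y. y \<in> K \<Longrightarrow> f y = g y"
  shows "triangle_integral K f = triangle_integral K g"
proof -
  let ?P = "\<lambda>(p, q, r). K = convex hull {p, q, r}"
  obtain p' q' r' where e: "(SOME z. ?P z) = (p', q', r')" by (cases "SOME z. ?P z")
  have "?P (SOME z. ?P z)" by (rule someI[of _ "(p, q, r)"]) (simp add: K)
  then have "param_integral p' q' r' f = param_integral p' q' r' g"
    using eq by (intro param_integral_cong) (simp add: e)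
  then show ?thesis by (simp add: triangle_integral_def e)
qed

lemma triangle_integral_mult: "triangle_integral K (\<lambda>y. c * f y) = c * triangle_integral K f"
  by (simp add: triangle_integral_def param_integral_eq set_lebesgue_integral_def mult.left_commute
      split: prod.split)

lemma surface_integral_mult: "surface_integral Kh (\<lambda>y. c * f y) = c * surface_integral Kh f"
  by (simp add: surface_integral_def triangle_integral_mult sum_distrib_left)

lemma not_collinear_cross3:
  "\<not> collinear {p, q, r} \<Longrightarrow> cross3 (q - p) (r - p) \<noteq> 0"
  using collinear_3[of q p r] by (simp add: cross_eq_0 insert_commute)

text \<open>On the square with side \<open>1/4\<close> at the vertex where \<open>f\<close> equals 1, \<open>f\<close> is at least \<open>1/2\<close>.\<close>

lemma triangle_integral_hat_pos:
  assumes tri: "\<not> collinear {p, q, r}" and K: "K = convex hull {p, q, r}"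
    and f: "\<And>y. y \<in> K \<Longrightarrow> f y = g \<bullet> y + c" and "f p = 1" "f q = 0" "f r = 0"
  shows "triangle_integral K f > 0"
proof -
  let ?h = "\<lambda>z :: real \<times> real. 1 - fst z - snd z"
  have mem: "p \<in> K" "q \<in> K" "r \<in> K" by (auto simp: K hull_inc)
  have v: "g \<bullet> p = 1 - c" "g \<bullet> q = - c" "g \<bullet> r = - c" using f mem assms(4-6) by force+
  have "param_integral p q r f = param_integral p q r (\<lambda>y. g \<bullet> y + c)"
    using f by (intro param_integral_cong) (simp add: K)
  also have "\<dots> = norm (cross3 (q - p) (r - p)) * (LINT z : reference_triangle | lborel. ?h z)"
    by (simp add: param_integral_eq inner_add_right inner_diff_right v algebra_simps)
  also have "\<dots> > 0"
  proof (rule mult_pos_pos)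
    show "norm (cross3 (q - p) (r - p)) > 0" using not_collinear_cross3[OF tri] by simp
    let ?B = "cbox (0, 0) (1/4, 1/4) :: (real \<times> real) set"
    have "0 < 1/2 * measure lborel ?B" by (simp add: content_Pair)
    also have "\<dots> = (LINT z|lborel. indicat_real ?B z *\<^sub>R (1/2))" by simp
    also have "\<dots> \<le> (LINT z|lborel. indicat_real reference_triangle z *\<^sub>R ?h z)"
    proof (rule integral_mono)
      show "integrable lborel (\<lambda>z. indicat_real ?B z *\<^sub>R (1/2 :: real))"
        by (rule borel_integrable_compact) auto
      show "integrable lborel (\<lambda>z. indicat_real reference_triangle z *\<^sub>R ?h z)"
        by (intro borel_integrable_compact compact_reference_triangle continuous_intros)
    qed (auto simp: indicator_def reference_triangle_def cbox_Pair_eq)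
    finally show "0 < (LINT z : reference_triangle | lborel. ?h z)"
      by (simp add: set_lebesgue_integral_def)
  qed
  finally show ?thesis using triangle_integral_convex_hull[OF tri] by (simp add: K)
qed

lemma triangle_integral_one:
  assumes "\<not> collinear {p, q, r}"
  shows "triangle_integral (convex hull {p, q, r}) (\<lambda>_. 1)
    = norm (cross3 (q - p) (r - p)) * (LINT z : reference_triangle | lborel. 1)"
  by (simp add: triangle_integral_convex_hull[OF assms] param_integral_eq)

section \<open>Gradients of affine functions on a convex set\<close>

text \<open>The direction space of the affine hull of \<open>K\<close>; for a triangle, its tangent plane.\<close>

definition directions :: "'a::real_vector set \<Rightarrow> 'a set" where
  "directions K = span {u - v |u v. u \<in> K \<and> v \<in> K}"

text \<open>The gradient of an affine function along \<open>K\<close>, characterised by differences instead of limits, so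
  that it is visibly linear in the function and can be read off at the vertices.\<close>

definition represents_slope :: "'a::real_inner set \<Rightarrow> ('a \<Rightarrow> real) \<Rightarrow> 'a \<Rightarrow> bool" where
  "represents_slope K f g \<longleftrightarrow> g \<in> directions K \<and> (\<forall>y\<in>K. \<forall>z\<in>K. f z - f y = g \<bullet> (z - y))"

text \<open>The orthogonal projection of the ambient gradient to the direction space.\<close>

lemma represents_slope_exists:
  fixes K :: "'a::euclidean_space set"
  assumes "\<And>y. y \<in> K \<Longrightarrow> f y = g \<bullet> y + c"
  shows "\<exists>G. represents_slope K f G"
proof -
  obtain G n where G: "G \<in> directions K" and n: "\<And>w. w \<in> directions K \<Longrightarrow> orthogonal n w"
    and g: "g = G + n"
    unfolding directions_def using orthogonal_subspace_decomp_exists by blast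
  have "f z - f y = G \<bullet> (z - y)" if "y \<in> K" "z \<in> K" for y z
  proof -
    have "z - y \<in> directions K" unfolding directions_def using that by (intro span_base) blast
    then have "n \<bullet> (z - y) = 0" using n by (auto simp: orthogonal_def)
    then show ?thesis using that by (simp add: assms g inner_diff_right inner_add_left)
  qed
  with G show ?thesis by (auto simp: represents_slope_def)
qed

lemma directions_orthogonal_eq_0:
  assumes g: "g \<in> directions K" and y: "y \<in> K" and orth: "\<And>z. z \<in> K \<Longrightarrow> g \<bullet> (z - y) = 0"
  shows "g = 0"
proof -
  have "orthogonal g w" if "w \<in> directions K" for w
    using that unfolding directions_def
  proof (rule orthogonal_to_span)
    fix w assume "w \<in> {u - v |u v. u \<in> K \<and> v \<in> K}"
    then obtain u v where "w = (u - y) - (v - y)" "u \<in> K" "v \<in> K" by auto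
    then show "orthogonal g w" using orth by (simp add: orthogonal_def inner_diff_right)
  qed
  from this[OF g] show ?thesis by (simp add: orthogonal_def)
qed

text \<open>A derivative within a convex set is determined on all directions of the set, since it can be
  computed along the segments towards the other points.\<close>

lemma tangential_gradient_eq:
  assumes K: "convex K" and y: "y \<in> K" and G: "represents_slope K f G"
  shows "tangential_gradient K f y = G"
proof -
  have "((\<lambda>z. G \<bullet> z + (f y - G \<bullet> y)) has_derivative (\<lambda>w. G \<bullet> w)) (at y within K)"
    by (auto intro!: derivative_eq_intros)
  then have derG: "(f has_derivative (\<lambda>w. G \<bullet> w)) (at y within K)"
  proof (rule has_derivative_transform_within[OF _ zero_less_one y])
    fix z assume "z \<in> K"
    then have "f z - f y = G \<bullet> (z - y)" using G y by (auto simp: represents_slope_def)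
    then show "G \<bullet> z + (f y - G \<bullet> y) = f z" by (simp add: inner_diff_right)
  qed
  show ?thesis
    unfolding tangential_gradient_def
  proof (rule the_equality)
    show "G \<in> span {u - v |u v. u \<in> K \<and> v \<in> K} \<and> (f has_derivative (\<lambda>w. G \<bullet> w)) (at y within K)"
      using G derG by (simp add: represents_slope_def directions_def)
  next
    fix g assume g: "g \<in> span {u - v |u v. u \<in> K \<and> v \<in> K} \<and> (f has_derivative (\<lambda>w. g \<bullet> w)) (at y within K)"
    have "(g - G) \<bullet> (z - y) = 0" if z: "z \<in> K" for z
    proof -
      let ?c = "\<lambda>t. y + t *\<^sub>R (z - y)"
      have c: "?c t \<in> K" if "t \<in> {0..1}" for t
        using convexD[OF K y z, of "1 - t" t] that by (simp add: algebra_simps)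
      have path: "((\<lambda>t. f (?c t)) has_vector_derivative k \<bullet> (z - y)) (at 0 within {0..1})"
        if k: "(f has_derivative (\<lambda>w. k \<bullet> w)) (at y within K)" for k
      proof -
        have "(?c has_derivative (\<lambda>t. t *\<^sub>R (z - y))) (at 0 within {0..1})"
          by (auto intro!: derivative_eq_intros)
        moreover have "(f has_derivative (\<lambda>w. k \<bullet> w)) (at (?c 0) within ?c ` {0..1})"
          using has_derivative_subset[OF k] c by (simp add: image_subset_iff)
        ultimately have "((\<lambda>t. f (?c t)) has_derivative (\<lambda>t. k \<bullet> (t *\<^sub>R (z - y)))) (at 0 within {0..1})"
          by (rule has_derivative_in_compose)
        then show ?thesis by (simp add: has_vector_derivative_def)
      qed
      have "at (0::real) within {0..1} \<noteq> bot" by (simp add: at_within_Icc_at_right)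
      then have "g \<bullet> (z - y) = G \<bullet> (z - y)"
        using path[OF derG] path[of g] g by (blast intro: vector_derivative_unique_within)
      then show ?thesis by (simp add: inner_diff_left)
    qed
    moreover have "g - G \<in> directions K"
      using g G by (simp add: represents_slope_def directions_def span_diff)
    ultimately have "g - G = 0" using directions_orthogonal_eq_0 y by blast
    then show "g = G" by simp
  qed
qed

lemma represents_slope_sum:
  assumes "\<And>i. i \<in> I \<Longrightarrow> represents_slope K (f i) (G i)"
  shows "represents_slope K (\<lambda>y. \<Sum>i\<in>I. c i * f i y) (\<Sum>i\<in>I. c i *\<^sub>R G i)"
proof -
  have "(\<Sum>i\<in>I. c i *\<^sub>R G i) \<in> directions K"
    using assms unfolding directions_def represents_slope_def by (intro span_sum span_mul) auto
  moreover have "(\<Sum>i\<in>I. c i * f i z) - (\<Sum>i\<in>I. c i * f i y) = (\<Sum>i\<in>I. c i *\<^sub>R G i) \<bullet> (z - y)"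
    if "y \<in> K" "z \<in> K" for y z
  proof -
    have "c i * f i z - c i * f i y = (c i *\<^sub>R G i) \<bullet> (z - y)" if i: "i \<in> I" for i
      using assms[OF i] \<open>y \<in> K\<close> \<open>z \<in> K\<close>
      by (auto simp: represents_slope_def simp flip: right_diff_distrib)
    then show ?thesis by (simp add: inner_sum_left flip: sum_subtractf)
  qed
  ultimately show ?thesis by (auto simp: represents_slope_def)
qed

text \<open>A level set of a linear function is convex, so it contains the hull of \<open>C\<close> as soon as it contains \<open>C\<close>.\<close>

lemma slope_eq_0_if_constant_on_vertices:
  assumes G: "represents_slope (convex hull C) f G" and C: "\<And>v. v \<in> C \<Longrightarrow> f v = b" "C \<noteq> {}"
  shows "G = 0"
proof -
  obtain v where v: "v \<in> C" using C(2) by blast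
  have "G \<bullet> (w - v) = 0" if w: "w \<in> C" for w
  proof -
    have "f w - f v = G \<bullet> (w - v)"
      using G hull_inc[OF v] hull_inc[OF w] unfolding represents_slope_def by blast
    then show ?thesis using C(1) v w by simp
  qed
  then have "C \<subseteq> {z. G \<bullet> z = G \<bullet> v}" by (auto simp: inner_diff_right)
  then have sub: "convex hull C \<subseteq> {z. G \<bullet> z = G \<bullet> v}" by (intro hull_minimal convex_hyperplane)
  have orth: "G \<bullet> (z - v) = 0" if "z \<in> convex hull C" for z
    using subsetD[OF sub that] by (simp add: inner_diff_right)
  have "G \<in> directions (convex hull C)" using G by (simp add: represents_slope_def)
  then show ?thesis using hull_inc[OF v] orth by (rule directions_orthogonal_eq_0)
qed

section \<open>The cotangent formula\<close>

lemma directions_triangle: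
  "directions (convex hull {p, q, r}) \<subseteq> span {p - r, q - r}"
proof -
  have "w \<in> (\<lambda>z. z - r) -` span {p - r, q - r}" if w: "w \<in> convex hull {p, q, r}" for w
  proof -
    obtain a b c where "w = a *\<^sub>R p + b *\<^sub>R q + c *\<^sub>R r" "a + b + c = 1"
      using w unfolding convex_hull_3 by blast
    moreover from this have "c = 1 - a - b" by simp
    ultimately have "w - r = a *\<^sub>R (p - r) + b *\<^sub>R (q - r)"
      by (simp add: algebra_simps)
    moreover have "a *\<^sub>R (p - r) + b *\<^sub>R (q - r) \<in> span {p - r, q - r}"
      by (intro span_add span_mul span_base) auto
    ultimately show ?thesis by simp
  qed
  then have "u - v \<in> span {p - r, q - r}"
    if "u \<in> convex hull {p, q, r}" "v \<in> convex hull {p, q, r}" for u v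
    using span_diff[of "u - r" _ "v - r"] that by fastforce
  then show ?thesis
    unfolding directions_def by (intro span_minimal subspace_span) auto
qed

text \<open>In the plane spanned by \<open>u\<close> and \<open>v\<close>, \<open>G\<close> is the member of the dual basis belonging to \<open>u\<close>, and
  \<open>H\<close> acts there as the one belonging to \<open>v\<close>. Pairing \<open>G\<close> with \<open>H\<close> reads off the coefficient of \<open>G\<close> at \<open>v\<close>,
  and Cramer's rule computes this coefficient; the determinant is the squared norm of the cross product.\<close>

lemma dual_basis_inner:
  fixes u v G H :: "real^3"
  assumes "G \<in> span {u, v}" and "G \<bullet> u = 1" "G \<bullet> v = 0" "H \<bullet> u = 0" "H \<bullet> v = 1"
  shows "(norm (cross3 u v))\<^sup>2 * (G \<bullet> H) = - (u \<bullet> v)"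
proof -
  obtain a b where G: "G = a *\<^sub>R u + b *\<^sub>R v"
    using assms(1) by (auto simp: span_insert span_singleton algebra_simps)
  have 1: "a * (u \<bullet> u) + b * (u \<bullet> v) = 1" "a * (u \<bullet> v) + b * (v \<bullet> v) = 0"
    using assms(2,3) by (simp_all add: G inner_add_left inner_commute[of v u])
  have "H \<bullet> G = b" using assms(4,5) by (simp add: G inner_add_right)
  then have "G \<bullet> H = b" by (simp add: inner_commute)
  moreover have "(norm (cross3 u v))\<^sup>2 = (u \<bullet> u) * (v \<bullet> v) - (u \<bullet> v)\<^sup>2"
    using norm_cross[of u v] by (simp only: power2_norm_eq_inner)
  moreover have "((u \<bullet> u) * (v \<bullet> v) - (u \<bullet> v)\<^sup>2) * b = - (u \<bullet> v)"
    using 1 by algebra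
  ultimately show ?thesis by simp
qed

lemma angle_at_cos_sin:
  fixes p q r :: "real^3"
  assumes "cross3 (p - r) (q - r) \<noteq> 0"
  defines "\<theta> \<equiv> angle_at r p q"
  shows "norm (p - r) * norm (q - r) * cos \<theta> = (p - r) \<bullet> (q - r)"
    and "norm (p - r) * norm (q - r) * sin \<theta> = norm (cross3 (p - r) (q - r))"
    and "0 < \<theta>" "\<theta> < pi"
proof -
  define u v where "u = p - r" "v = q - r"
  note uv = this
  have n: "norm u * norm v > 0" using assms(1) by (auto simp: uv zero_less_mult_iff)
  have C: "\<bar>(u \<bullet> v) / (norm u * norm v)\<bar> \<le> 1"
    using Cauchy_Schwarz_ineq2[of u v] n by (simp add: field_simps abs_mult)
  then have cos: "cos \<theta> = (u \<bullet> v) / (norm u * norm v)"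
    unfolding \<theta>_def angle_at_def uv by (simp add: cos_arccos_abs)
  with n show 1: "norm (p - r) * norm (q - r) * cos \<theta> = (p - r) \<bullet> (q - r)"
    by (auto simp: uv)
  have range: "0 \<le> \<theta>" "\<theta> \<le> pi"
    using C[unfolded abs_le_iff] unfolding \<theta>_def angle_at_def uv by (auto intro!: arccos_lbound arccos_ubound)
  then have s: "sin \<theta> \<ge> 0" by (rule sin_ge_zero)
  have "(norm u * norm v * sin \<theta>)\<^sup>2 = (norm u * norm v)\<^sup>2 - (norm u * norm v * cos \<theta>)\<^sup>2"
    by (simp add: power_mult_distrib sin_squared_eq algebra_simps)
  also have "\<dots> = (norm (cross3 u v))\<^sup>2"
    using 1 norm_cross_dot[of u v] by (simp add: uv)
  finally show 2: "norm (p - r) * norm (q - r) * sin \<theta> = norm (cross3 (p - r) (q - r))"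
    using s n by (simp add: uv power2_eq_iff_nonneg)
  then have "sin \<theta> \<noteq> 0" using assms(1) by auto
  then show "0 < \<theta>" "\<theta> < pi" using range by (auto simp: less_le)
qed

text \<open>The sum of the cotangents has the sign of \<open>sin (\<theta> + \<theta>')\<close>.\<close>

lemma cot_sum_nonneg:
  assumes "0 < \<theta>" "\<theta> < pi" "0 < \<theta>'" "\<theta>' < pi" "\<theta> + \<theta>' \<le> pi"
  shows "cos \<theta> / sin \<theta> + cos \<theta>' / sin \<theta>' \<ge> 0"
proof -
  have pos: "sin \<theta> > 0" "sin \<theta>' > 0" using assms by (auto intro: sin_gt_zero)
  have "cos \<theta> / sin \<theta> + cos \<theta>' / sin \<theta>' = sin (\<theta> + \<theta>') / (sin \<theta> * sin \<theta>')"
    using pos by (simp add: sin_add field_simps)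
  also have "\<dots> \<ge> 0" using pos assms by (auto intro!: divide_nonneg_pos sin_ge_zero)
  finally show ?thesis .
qed

text \<open>The classical cotangent formula: up to a constant that is the same for all triangles, the local
  stiffness entry of the edge from \<open>p\<close> to \<open>q\<close> is minus the cotangent of the opposite angle. The
  constant is the area of the reference triangle.\<close>

lemma hat_gradients_cot:
  fixes p q r :: "real^3"
  assumes tri: "\<not> collinear {p, q, r}" and K: "K = convex hull {p, q, r}"
    and f: "represents_slope K f F" "f p = 1" "f q = 0" "f r = 0"
    and g: "represents_slope K g G" "g p = 0" "g q = 1" "g r = 0"
  defines "\<theta> \<equiv> angle_at r p q"
  shows "triangle_integral K (\<lambda>_. 1) * (F \<bullet> G)
    = - (cos \<theta> / sin \<theta>) * (LINT z : reference_triangle | lborel. 1)"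
    and "0 < \<theta>" "\<theta> < pi"
proof -
  define u v where "u = p - r" "v = q - r"
  note uv = this
  have tri': "\<not> collinear {r, p, q}" using tri by (simp add: insert_commute)
  have cr: "cross3 u v \<noteq> 0" using not_collinear_cross3[OF tri'] by (simp add: uv)
  note angle = angle_at_cos_sin[OF cr[unfolded uv], folded \<theta>_def uv]
  show "0 < \<theta>" "\<theta> < pi" by (fact angle)+
  have mem: "p \<in> K" "q \<in> K" "r \<in> K" by (auto simp: K hull_inc)
  have slope: "F \<bullet> (z - y) = f z - f y" "G \<bullet> (z - y) = g z - g y"
    if "y \<in> K" "z \<in> K" for y z
    using f(1) g(1) that by (auto simp: represents_slope_def)
  have "F \<in> span {u, v}"
    using f(1) directions_triangle by (auto simp: represents_slope_def K uv)
  moreover have "F \<bullet> u = 1" "F \<bullet> v = 0" "G \<bullet> u = 0" "G \<bullet> v = 1"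
    by (simp_all add: uv slope mem f g)
  ultimately have "(norm (cross3 u v))\<^sup>2 * (F \<bullet> G) = - (u \<bullet> v)"
    by (rule dual_basis_inner)
  then have "norm (cross3 u v) * (F \<bullet> G) = - ((u \<bullet> v) / norm (cross3 u v))"
    using cr by (simp add: power2_eq_square field_simps)
  also have "\<dots> = - (cos \<theta> / sin \<theta>)"
  proof -
    have "norm u * norm v \<noteq> 0" using cr by auto
    then show ?thesis unfolding angle(1,2)[symmetric] by simp
  qed
  finally have inner: "norm (cross3 u v) * (F \<bullet> G) = - (cos \<theta> / sin \<theta>)" .
  have "triangle_integral K (\<lambda>_. 1)
      = norm (cross3 u v) * (LINT z : reference_triangle | lborel. 1)"
    using triangle_integral_one[OF tri'] by (simp add: K uv insert_commute)
  then have "triangle_integral K (\<lambda>_. 1) * (F \<bullet> G)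
    = norm (cross3 u v) * (F \<bullet> G) * (LINT z : reference_triangle | lborel. 1)"
    by (simp only: mult.assoc mult.commute[of "F \<bullet> G"])
  then show "triangle_integral K (\<lambda>_. 1) * (F \<bullet> G)
    = - (cos \<theta> / sin \<theta>) * (LINT z : reference_triangle | lborel. 1)"
    by (simp only: inner)
qed

section \<open>Vertices, edges and triangles of the mesh\<close>

context triangulated_surface
begin

lemma triangle_obtain:
  assumes "K \<in> Kh"
  obtains p q r where "\<not> collinear {p, q, r}" "K = convex hull {p, q, r}"
    "{v. v extreme_point_of K} = {p, q, r}"
proof -
  obtain C where C: "\<not> affine_dependent C" "int (card C) = 2 + 1" "K = convex hull C"
    using triangles assms unfolding simplex_def by blast
  then have "card C = 3" by simp
  then obtain p q r where pqr: "C = {p, q, r}" "p \<noteq> q" "q \<noteq> r" "p \<noteq> r"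
    by (auto simp: card_3_iff)
  have "\<not> collinear {p, q, r}"
    using C(1) pqr by (simp add: collinear_3_eq_affine_dependent)
  moreover have "{v. v extreme_point_of K} = {p, q, r}"
    using extreme_point_of_convex_hull_affine_independent[OF C(1)] C(3) pqr(1) by auto
  ultimately show ?thesis using that C(3) pqr(1) by blast
qed

lemma triangle_obtain_at:
  assumes "K \<in> Kh" "p extreme_point_of K"
  obtains q r where "\<not> collinear {p, q, r}" "K = convex hull {p, q, r}"
    "{v. v extreme_point_of K} = {p, q, r}"
proof -
  obtain p' q' r' where *: "\<not> collinear {p', q', r'}" "K = convex hull {p', q', r'}"
    "{v. v extreme_point_of K} = {p', q', r'}" by (rule triangle_obtain[OF assms(1)])
  from *(3) assms(2) have "p \<in> {p', q', r'}" by blast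
  then consider "p = p'" | "p = q'" | "p = r'" by blast
  then show ?thesis
    by cases (use that[of q' r'] that[of p' r'] that[of p' q'] * in \<open>simp_all add: insert_commute\<close>)
qed

lemma triangle_obtain_at2:
  assumes "K \<in> Kh" "p extreme_point_of K" "q extreme_point_of K" "p \<noteq> q"
  obtains r where "\<not> collinear {p, q, r}" "K = convex hull {p, q, r}"
    "{v. v extreme_point_of K} = {p, q, r}"
proof -
  obtain q' r' where *: "\<not> collinear {p, q', r'}" "K = convex hull {p, q', r'}"
    "{v. v extreme_point_of K} = {p, q', r'}" by (rule triangle_obtain_at[OF assms(1,2)])
  from *(3) assms(3) have "q \<in> {p, q', r'}" by blast
  with assms(4) consider "q = q'" | "q = r'" by blast
  then show ?thesis
    by cases (use that[of r'] that[of q'] * in \<open>simp_all add: insert_commute\<close>)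
qed

lemma triangle_convex: "K \<in> Kh \<Longrightarrow> convex K"
  by (rule triangle_obtain) (auto simp: convex_convex_hull)

lemma triangle_eq_hull_vertices:
  assumes "K \<in> Kh"
  shows "K = convex hull {v. v extreme_point_of K}" "{v. v extreme_point_of K} \<noteq> {}"
proof -
  obtain p q r where *: "K = convex hull {p, q, r}" "{v. v extreme_point_of K} = {p, q, r}"
    by (rule triangle_obtain[OF assms])
  show "K = convex hull {v. v extreme_point_of K}" unfolding *(2) by (fact *(1))
  show "{v. v extreme_point_of K} \<noteq> {}" unfolding *(2) by simp
qed

lemma finite_mesh: "finite Kh"
  using conforming by (simp add: triangulation_def)

lemma vertex_index:
  assumes "K \<in> Kh" "v extreme_point_of K"
  obtains j where "j \<in> {1..N}" "v = x j"
proof -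
  have "v \<in> x ` {1..N}" using assms enum_vertices by (auto simp: bij_betw_def vertices_def)
  with that show ?thesis by blast
qed

lemma vertex_triangle:
  assumes "i \<in> {1..N}"
  obtains K where "K \<in> Kh" "x i extreme_point_of K"
proof -
  have "x i \<in> vertices Kh" using assms enum_vertices by (auto simp: bij_betw_def)
  with that show ?thesis by (auto simp: vertices_def)
qed

lemma vertex_in_triangle: "v extreme_point_of K \<Longrightarrow> v \<in> K"
  by (simp add: extreme_point_of_def)

lemma vertex_inj: "i \<in> {1..N} \<Longrightarrow> j \<in> {1..N} \<Longrightarrow> x i = x j \<longleftrightarrow> i = j"
  by (rule inj_on_eq_iff[OF bij_betw_imp_inj_on[OF enum_vertices]])

text \<open>The faces of a simplex are the hulls of its sets of vertices, so any two vertices span an edge.\<close>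

lemma edge_iff_endpoints:
  assumes K: "K \<in> Kh" and pq: "p \<noteq> q"
  shows "closed_segment p q edge_of K \<longleftrightarrow> p extreme_point_of K \<and> q extreme_point_of K"
proof
  assume "closed_segment p q edge_of K"
  then have "closed_segment p q face_of K" by (simp add: edge_of_def)
  from extreme_point_of_face[OF this, of p] extreme_point_of_face[OF this, of q]
  show "p extreme_point_of K \<and> q extreme_point_of K"
    by (simp add: extreme_point_of_segment)
next
  assume "p extreme_point_of K \<and> q extreme_point_of K"
  then obtain r where r: "\<not> collinear {p, q, r}" "K = convex hull {p, q, r}"
    using triangle_obtain_at2[OF K _ _ pq] by blast
  then have aff: "\<not> affine_dependent {p, q, r}"
    using collinear_3_eq_affine_dependent by blast
  have "\<exists>c\<subseteq>{p, q, r}. convex hull {p, q} = convex hull c"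
    by (rule exI[of _ "{p, q}"]) simp
  then have "convex hull {p, q} face_of K"
    unfolding r(2) face_of_convex_hull_affine_independent[OF aff] .
  moreover have "aff_dim (convex hull {p, q}) = 1" using pq by (simp add: aff_dim_convex_hull)
  ultimately show "closed_segment p q edge_of K" by (simp add: edge_of_def segment_convex_hull)
qed

text \<open>Since the surface is closed, the triangles containing two given vertices are either none or
  exactly two, the two triangles at their common edge.\<close>

lemma triangles_at_two_vertices:
  assumes "p \<noteq> q"
  shows "{K \<in> Kh. p extreme_point_of K \<and> q extreme_point_of K} = {} \<or>
    card {K \<in> Kh. p extreme_point_of K \<and> q extreme_point_of K} = 2"
proof -
  have "{K \<in> Kh. p extreme_point_of K \<and> q extreme_point_of K} = {K \<in> Kh. closed_segment p q edge_of K}"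
    using edge_iff_endpoints assms by blast
  then show ?thesis using closed_surface by fastforce
qed

end

section \<open>Mass and stiffness matrix\<close>

locale nodal_surface = triangulated_surface +
  fixes \<psi> :: "nat \<Rightarrow> real^3 \<Rightarrow> real"
  assumes nodal: "nodal_basis Kh N x \<psi>"
begin

definition hat_gradient :: "(real^3) set \<Rightarrow> nat \<Rightarrow> real^3" where
  "hat_gradient K i = (SOME G. represents_slope K (\<psi> i) G)"

definition area :: "(real^3) set \<Rightarrow> real" where
  "area K = triangle_integral K (\<lambda>_. 1)"

definition stiffness :: "nat \<Rightarrow> nat \<Rightarrow> real" where
  "stiffness i j = (\<Sum>K\<in>Kh. area K * (hat_gradient K i \<bullet> hat_gradient K j))"

lemma hat_at_vertex: "i \<in> {1..N} \<Longrightarrow> j \<in> {1..N} \<Longrightarrow> \<psi> i (x j) = (if i = j then 1 else 0)"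
  using nodal by (simp add: nodal_basis_def)

lemma hat_affine:
  assumes "i \<in> {1..N}" "K \<in> Kh"
  shows "\<exists>g c. \<forall>y\<in>K. \<psi> i y = g \<bullet> y + c"
proof -
  have "\<psi> i \<in> Sh Kh" using nodal assms by (simp add: nodal_basis_def)
  then show ?thesis using assms(2) unfolding Sh_def by blast
qed

lemma hat_at_vertex_of:
  assumes "i \<in> {1..N}" "K \<in> Kh" "v extreme_point_of K"
  shows "\<psi> i v = (if v = x i then 1 else 0)"
proof -
  obtain j where j: "j \<in> {1..N}" "v = x j" by (rule vertex_index[OF assms(2,3)])
  show ?thesis unfolding j(2) hat_at_vertex[OF assms(1) j(1)] vertex_inj[OF j(1) assms(1)] by simp
qed

lemma hat_gradient:
  assumes "i \<in> {1..N}" "K \<in> Kh"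
  shows "represents_slope K (\<psi> i) (hat_gradient K i)"
proof -
  obtain g c where "\<And>y. y \<in> K \<Longrightarrow> \<psi> i y = g \<bullet> y + c" using hat_affine[OF assms] by blast
  then have "\<exists>G. represents_slope K (\<psi> i) G" by (rule represents_slope_exists)
  then show ?thesis unfolding hat_gradient_def by (rule someI_ex)
qed

lemma area_nonneg: "K \<in> Kh \<Longrightarrow> area K \<ge> 0"
proof -
  assume "K \<in> Kh"
  then obtain p q r where "\<not> collinear {p, q, r}" "K = convex hull {p, q, r}"
    by (rule triangle_obtain)
  then show ?thesis
    by (simp add: area_def triangle_integral_one set_lebesgue_integral_def)
qed

text \<open>A hat function lives on the triangles around its vertex.\<close>

lemma hat_gradient_eq_0:
  assumes i: "i \<in> {1..N}" and K: "K \<in> Kh" and no: "\<not> x i extreme_point_of K"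
  shows "hat_gradient K i = 0"
proof (rule slope_eq_0_if_constant_on_vertices[where C = "{v. v extreme_point_of K}" and b = 0])
  show "represents_slope (convex hull {v. v extreme_point_of K}) (\<psi> i) (hat_gradient K i)"
    using hat_gradient[OF i K] triangle_eq_hull_vertices(1)[OF K] by argo
  show "{v. v extreme_point_of K} \<noteq> {}" by (rule triangle_eq_hull_vertices(2)[OF K])
  show "\<psi> i v = 0" if "v \<in> {v. v extreme_point_of K}" for v
    using hat_at_vertex_of[OF i K, of v] no that by (metis mem_Collect_eq)
qed

text \<open>The hat functions add up to 1 at every vertex.\<close>

lemma sum_hat_gradients:
  assumes K: "K \<in> Kh"
  shows "(\<Sum>i=1..N. hat_gradient K i) = 0"
proof (rule slope_eq_0_if_constant_on_vertices[where C = "{v. v extreme_point_of K}" and b = 1])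
  have "represents_slope K (\<lambda>y. \<Sum>i=1..N. 1 * \<psi> i y) (\<Sum>i=1..N. 1 *\<^sub>R hat_gradient K i)"
    using hat_gradient K by (intro represents_slope_sum) auto
  then show "represents_slope (convex hull {v. v extreme_point_of K})
      (\<lambda>y. \<Sum>i=1..N. \<psi> i y) (\<Sum>i=1..N. hat_gradient K i)"
    unfolding triangle_eq_hull_vertices(1)[OF K, symmetric] mult_1 scaleR_one .
  show "{v. v extreme_point_of K} \<noteq> {}" by (rule triangle_eq_hull_vertices(2)[OF K])
  show "(\<Sum>i=1..N. \<psi> i v) = 1" if v: "v \<in> {v. v extreme_point_of K}" for v
  proof -
    obtain j where j: "j \<in> {1..N}" "v = x j" using vertex_index[OF K] v by blast
    have "(\<Sum>i=1..N. \<psi> i v) = (\<Sum>i=1..N. if i = j then 1 else 0)"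
      using j by (intro sum.cong) (simp_all add: hat_at_vertex)
    then show ?thesis using j by simp
  qed
qed

lemma hat_mass_pos:
  assumes i: "i \<in> {1..N}"
  shows "surface_integral Kh (\<psi> i) > 0"
proof -
  have pos: "triangle_integral K (\<psi> i) > 0" if K: "K \<in> Kh" and v: "x i extreme_point_of K" for K
  proof -
    obtain q r where qr: "\<not> collinear {x i, q, r}" "K = convex hull {x i, q, r}"
      "{v. v extreme_point_of K} = {x i, q, r}" by (rule triangle_obtain_at[OF K v])
    then have "q extreme_point_of K" "r extreme_point_of K" "q \<noteq> x i" "r \<noteq> x i"
      unfolding collinear_3_eq_affine_dependent by blast+
    then have at: "\<psi> i (x i) = 1" "\<psi> i q = 0" "\<psi> i r = 0"
      using v by (simp_all add: hat_at_vertex_of[OF i K])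
    obtain g c where "\<And>y. y \<in> K \<Longrightarrow> \<psi> i y = g \<bullet> y + c" using hat_affine[OF i K] by blast
    from triangle_integral_hat_pos[OF qr(1,2) this at] show ?thesis .
  qed
  have zero: "triangle_integral K (\<psi> i) = 0" if K: "K \<in> Kh" and no: "\<not> x i extreme_point_of K" for K
  proof -
    obtain p q r where pqr: "K = convex hull {p, q, r}" "{v. v extreme_point_of K} = {p, q, r}"
      by (rule triangle_obtain[OF K])
    then have p: "p extreme_point_of K" by blast
    then have "\<psi> i p = 0" using hat_at_vertex_of[OF i K] no by metis
    then have "\<psi> i y = 0 * \<psi> i y" if "y \<in> K" for y
    proof -
      have "\<psi> i y - \<psi> i p = hat_gradient K i \<bullet> (y - p)"
        using hat_gradient[OF i K] vertex_in_triangle[OF p] that unfolding represents_slope_def by blast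
      then show ?thesis using \<open>\<psi> i p = 0\<close> by (simp add: hat_gradient_eq_0[OF i K no])
    qed
    then have "triangle_integral K (\<psi> i) = triangle_integral K (\<lambda>y. 0 * \<psi> i y)"
      by (rule triangle_integral_cong[OF pqr(1)])
    also have "\<dots> = 0 * triangle_integral K (\<psi> i)" by (rule triangle_integral_mult)
    finally show ?thesis by simp
  qed
  obtain K where K: "K \<in> Kh" "x i extreme_point_of K" by (rule vertex_triangle[OF i])
  show ?thesis
    unfolding surface_integral_def
  proof (rule sum_pos2[OF finite_mesh K(1)])
    show "0 < triangle_integral K (\<psi> i)" by (rule pos[OF K])
    show "0 \<le> triangle_integral K (\<psi> i)" if "K \<in> Kh" for K
      using pos[OF that] zero[OF that] by (cases "x i extreme_point_of K") simp_all
  qed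
qed

lemma dirichlet_form_hat:
  assumes i: "i \<in> {1..N}"
  shows "dirichlet_form Kh (\<lambda>y. \<Sum>j=1..N. c j * \<psi> j y) (\<psi> i) = (\<Sum>j=1..N. stiffness i j * c j)"
proof -
  let ?u = "\<lambda>y. \<Sum>j=1..N. c j * \<psi> j y" and ?G = "\<lambda>K. \<Sum>j=1..N. c j *\<^sub>R hat_gradient K j"
  have "triangle_integral K (\<lambda>y. tangential_gradient K ?u y \<bullet> tangential_gradient K (\<psi> i) y)
      = (\<Sum>j=1..N. area K * (hat_gradient K i \<bullet> hat_gradient K j) * c j)" if K: "K \<in> Kh" for K
  proof -
    obtain p q r where pqr: "K = convex hull {p, q, r}" by (rule triangle_obtain[OF K])
    have "represents_slope K ?u (?G K)"
      using hat_gradient K by (intro represents_slope_sum) auto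
    then have "triangle_integral K (\<lambda>y. tangential_gradient K ?u y \<bullet> tangential_gradient K (\<psi> i) y)
      = triangle_integral K (\<lambda>y. (?G K \<bullet> hat_gradient K i) * 1)"
      using hat_gradient[OF i K] tangential_gradient_eq[OF triangle_convex[OF K]]
      by (intro triangle_integral_cong[OF pqr]) simp
    also have "\<dots> = (hat_gradient K i \<bullet> ?G K) * area K"
      by (simp only: triangle_integral_mult area_def inner_commute)
    also have "\<dots> = (\<Sum>j=1..N. area K * (hat_gradient K i \<bullet> hat_gradient K j) * c j)"
      unfolding inner_sum_right inner_scaleR_right sum_distrib_right
      by (intro sum.cong refl) (simp only: mult.commute mult.left_commute)
    finally show ?thesis .
  qed
  then have "dirichlet_form Kh ?u (\<psi> i)
      = (\<Sum>K\<in>Kh. \<Sum>j=1..N. area K * (hat_gradient K i \<bullet> hat_gradient K j) * c j)"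
    unfolding dirichlet_form_def by (rule sum.cong[OF refl])
  also have "\<dots> = (\<Sum>j=1..N. \<Sum>K\<in>Kh. area K * (hat_gradient K i \<bullet> hat_gradient K j) * c j)"
    by (rule sum.swap)
  finally show ?thesis by (simp only: stiffness_def sum_distrib_right)
qed

lemma stiffness_row_sum: "(\<Sum>j=1..N. stiffness i j) = 0"
proof -
  have "(\<Sum>j=1..N. stiffness i j) = (\<Sum>K\<in>Kh. area K * (hat_gradient K i \<bullet> (\<Sum>j=1..N. hat_gradient K j)))"
    unfolding stiffness_def inner_sum_right sum_distrib_left by (rule sum.swap)
  also have "\<dots> = 0"
    by (intro sum.neutral ballI) (simp only: sum_hat_gradients inner_zero_right mult_zero_right)
  finally show ?thesis .
qed

text \<open>The quadratic form is the Dirichlet energy of the function with nodal values \<open>w\<close>.\<close>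

lemma stiffness_psd: "(\<Sum>i=1..N. \<Sum>j=1..N. w i * stiffness i j * w j) \<ge> 0"
proof -
  let ?G = "\<lambda>K. \<Sum>i=1..N. w i *\<^sub>R hat_gradient K i"
  have "(\<Sum>i=1..N. \<Sum>j=1..N. w i * stiffness i j * w j)
      = (\<Sum>i=1..N. \<Sum>j=1..N. \<Sum>K\<in>Kh. area K * ((w j *\<^sub>R hat_gradient K j) \<bullet> (w i *\<^sub>R hat_gradient K i)))"
    unfolding stiffness_def sum_distrib_left sum_distrib_right
    by (intro sum.cong refl) (simp add: inner_commute)
  also have "\<dots> = (\<Sum>i=1..N. \<Sum>K\<in>Kh. \<Sum>j=1..N. area K * ((w j *\<^sub>R hat_gradient K j) \<bullet> (w i *\<^sub>R hat_gradient K i)))"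
    by (intro sum.cong refl sum.swap)
  also have "\<dots> = (\<Sum>K\<in>Kh. \<Sum>i=1..N. \<Sum>j=1..N. area K * ((w j *\<^sub>R hat_gradient K j) \<bullet> (w i *\<^sub>R hat_gradient K i)))"
    by (rule sum.swap)
  also have "\<dots> = (\<Sum>K\<in>Kh. area K * (?G K \<bullet> ?G K))"
    by (simp only: inner_sum_left inner_sum_right sum_distrib_left)
  also have "\<dots> \<ge> 0" by (intro sum_nonneg mult_nonneg_nonneg area_nonneg inner_ge_zero)
  finally show ?thesis .
qed

text \<open>Only triangles containing both vertices contribute. If there are any, they are the two triangles at
  the common edge, and their contributions are, up to a common nonnegative factor, the negative cotangents of the two
  opposite angles.\<close>

lemma stiffness_off_diagonal:
  assumes angles: "angle_condition Kh" and i: "i \<in> {1..N}" and j: "j \<in> {1..N}" and ij: "i \<noteq> j"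
  shows "stiffness i j \<le> 0"
proof -
  let ?E = "{K \<in> Kh. x i extreme_point_of K \<and> x j extreme_point_of K}"
  let ?s = "\<lambda>K. area K * (hat_gradient K i \<bullet> hat_gradient K j)"
  have ne: "x i \<noteq> x j" using vertex_inj[OF i j] ij by simp
  have loc: "stiffness i j = (\<Sum>K\<in>?E. ?s K)"
    unfolding stiffness_def
  proof (rule sum.mono_neutral_right[OF finite_mesh])
    show "\<forall>K\<in>Kh - ?E. ?s K = 0"
    proof
      fix K assume "K \<in> Kh - ?E"
      then consider "K \<in> Kh" "\<not> x i extreme_point_of K" | "K \<in> Kh" "\<not> x j extreme_point_of K"
        by blast
      then show "?s K = 0"
        by cases (simp_all add: hat_gradient_eq_0[OF i] hat_gradient_eq_0[OF j])
    qed
  qed blast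
  consider "?E = {}" | K1 K2 where "?E = {K1, K2}" "K1 \<noteq> K2"
    using triangles_at_two_vertices[OF ne] unfolding card_2_iff by blast
  then show ?thesis
  proof cases
    case 1
    show ?thesis unfolding loc 1 by simp
  next
    case (2 K1 K2)
    let ?\<kappa> = "LINT z : reference_triangle | lborel. (1::real)"
    let ?cot = "\<lambda>r. cos (angle_at r (x i) (x j)) / sin (angle_at r (x i) (x j))"
    have "\<forall>K\<in>?E. \<exists>r. K = convex hull {x i, x j, r} \<and> 0 < angle_at r (x i) (x j) \<and>
        angle_at r (x i) (x j) < pi \<and> ?s K = - ?cot r * ?\<kappa>"
    proof
      fix K assume KE: "K \<in> ?E"
      then have K: "K \<in> Kh" "x i extreme_point_of K" "x j extreme_point_of K" by auto
      obtain r where r: "\<not> collinear {x i, x j, r}" "K = convex hull {x i, x j, r}"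
        "{v. v extreme_point_of K} = {x i, x j, r}" by (rule triangle_obtain_at2[OF K ne])
      have rv: "r extreme_point_of K" "r \<noteq> x i" "r \<noteq> x j"
        using r unfolding collinear_3_eq_affine_dependent by blast+
      have at: "\<psi> i (x i) = 1" "\<psi> i (x j) = 0" "\<psi> i r = 0" "\<psi> j (x i) = 0" "\<psi> j (x j) = 1" "\<psi> j r = 0"
        using K rv ne by (simp_all add: hat_at_vertex_of[OF i K(1)] hat_at_vertex_of[OF j K(1)])
      note cot = hat_gradients_cot[OF r(1,2) hat_gradient[OF i K(1)] at(1-3) hat_gradient[OF j K(1)] at(4-6)]
      show "\<exists>r. K = convex hull {x i, x j, r} \<and> 0 < angle_at r (x i) (x j) \<and>
        angle_at r (x i) (x j) < pi \<and> ?s K = - ?cot r * ?\<kappa>"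
        unfolding area_def by (intro exI conjI) (fact r(2) cot)+
    qed
    from bchoice[OF this] obtain r where r_all: "\<forall>K\<in>?E. K = convex hull {x i, x j, r K} \<and>
        0 < angle_at (r K) (x i) (x j) \<and> angle_at (r K) (x i) (x j) < pi \<and> ?s K = - ?cot (r K) * ?\<kappa>" ..
    then have r: "K = convex hull {x i, x j, r K}" "0 < angle_at (r K) (x i) (x j)"
      "angle_at (r K) (x i) (x j) < pi" "?s K = - ?cot (r K) * ?\<kappa>" if "K \<in> ?E" for K
      using bspec[OF r_all that] by argo+
    define \<theta> where "\<theta> K = angle_at (r K) (x i) (x j)" for K
    have E: "K1 \<in> ?E" "K2 \<in> ?E" using 2 by auto
    have "\<theta> K1 + \<theta> K2 \<le> pi"
    proof -
      have "convex hull {x i, x j, r K1} \<in> Kh" "convex hull {x i, x j, r K2} \<in> Kh"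
        "convex hull {x i, x j, r K1} \<noteq> convex hull {x i, x j, r K2}"
        unfolding r(1)[OF E(1), symmetric] r(1)[OF E(2), symmetric] using E 2(2) by blast+
      then show ?thesis using angles unfolding angle_condition_def \<theta>_def by blast
    qed
    then have "cos (\<theta> K1) / sin (\<theta> K1) + cos (\<theta> K2) / sin (\<theta> K2) \<ge> 0"
      unfolding \<theta>_def by (intro cot_sum_nonneg r(2,3) E)
    moreover have "?\<kappa> \<ge> 0"
      by (simp add: set_lebesgue_integral_def)
    ultimately have "0 \<le> (cos (\<theta> K1) / sin (\<theta> K1) + cos (\<theta> K2) / sin (\<theta> K2)) * ?\<kappa>"
      by (rule mult_nonneg_nonneg)
    also have "\<dots> = - (?s K1 + ?s K2)"
      unfolding r(4)[OF E(1)] r(4)[OF E(2)] \<theta>_def by (simp add: distrib_right)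
    also have "?s K1 + ?s K2 = stiffness i j"
      unfolding loc 2(1) using 2(2) by simp
    finally show ?thesis by simp
  qed
qed

text \<open>This is mass lumping: the interpolated product with a hat function only sees the value at one vertex,
  so the mass matrix is diagonal.\<close>

lemma interpolant_times_hat:
  assumes i: "i \<in> {1..N}"
  shows "interpolant N x \<psi> (\<lambda>y. v y * \<psi> i y) = (\<lambda>y. v (x i) * \<psi> i y)"
proof
  fix y
  have "interpolant N x \<psi> (\<lambda>y. v y * \<psi> i y) y = (\<Sum>k=1..N. if k = i then v (x i) * \<psi> i y else 0)"
    unfolding interpolant_def using i by (intro sum.cong) (simp_all add: hat_at_vertex)
  then show "interpolant N x \<psi> (\<lambda>y. v y * \<psi> i y) y = v (x i) * \<psi> i y" using i by simp
qed

lemma hat_expansion_at_vertex: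
  assumes i: "i \<in> {1..N}"
  shows "(\<Sum>j=1..N. c j * \<psi> j (x i)) = c i"
proof -
  have "(\<Sum>j=1..N. c j * \<psi> j (x i)) = (\<Sum>j=1..N. if j = i then c i else 0)"
    using i by (intro sum.cong) (simp_all add: hat_at_vertex)
  then show ?thesis using i by simp
qed

section \<open>The system for the nodal values\<close>

text \<open>Testing with the hat functions gives the system almost everywhere. The nodal values are integrals
  of integrable functions, hence continuous, and so is the right-hand side of the system.\<close>

lemma nodal_values_solve_ode:
  fixes \<xi> :: "nat \<Rightarrow> real \<Rightarrow> real" and d \<beta> \<alpha> :: real
  defines "D \<equiv> \<lambda>i t. - d * (\<Sum>j=1..N. stiffness i j * \<xi> j t) / surface_integral Kh (\<psi> i)
    - \<beta> * real_power (\<xi> i t) \<alpha>"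
  assumes \<alpha>: "\<alpha> \<ge> 1"
    and sol: "semi_discrete_solution Kh N x \<psi> d \<beta> \<alpha> T (\<lambda>t y. \<Sum>i=1..N. \<xi> i t * \<psi> i y)"
    and i: "i \<in> {1..N}" and t: "t \<in> {0..T}"
  shows "(\<xi> i has_real_derivative D i t) (at t within {0..T})"
proof -
  obtain U' where L2: "L2_Sh Kh T U'"
    and der: "time_derivative Kh T (\<lambda>t y. \<Sum>i=1..N. \<xi> i t * \<psi> i y) U'"
    and weak: "AE t in lebesgue_on {0..T}. \<forall>\<phi>\<in>Sh Kh.
           surface_integral Kh (interpolant N x \<psi> (\<lambda>y. U' t y * \<phi> y))
             + d * dirichlet_form Kh (\<lambda>y. \<Sum>i=1..N. \<xi> i t * \<psi> i y) \<phi>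
           = - \<beta> * surface_integral Kh (interpolant N x \<psi>
               (\<lambda>y. real_power (\<Sum>i=1..N. \<xi> i t * \<psi> i y) \<alpha> * \<phi> y))"
    using sol unfolding semi_discrete_solution_def by blast
  have mem: "x i \<in> \<Union>Kh" if i: "i \<in> {1..N}" for i
    by (metis UnionI vertex_in_triangle vertex_triangle[OF i])
  have meas: "(\<lambda>t. U' t (x i)) \<in> borel_measurable (lebesgue_on {0..T})"
    and sq: "integrable (lebesgue_on {0..T}) (\<lambda>t. (U' t (x i))\<^sup>2)" if i: "i \<in> {1..N}" for i
    using L2 mem[OF i] by (auto simp: L2_Sh_def)
  have int: "\<xi> i t = \<xi> i 0 + (LINT s|lebesgue_on {0..t}. U' s (x i))"
    if i: "i \<in> {1..N}" and t: "t \<in> {0..T}" for i t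
    using bspec[OF bspec[OF der[unfolded time_derivative_def] mem[OF i]] t]
    by (simp only: hat_expansion_at_vertex[OF i])
  have "continuous_on {0..T} (\<xi> i)" if i: "i \<in> {1..N}" for i
    by (rule continuous_on_of_L2_derivative[OF meas[OF i] sq[OF i] int[OF i]])
  then have D: "continuous_on {0..T} (D i)"
    unfolding D_def using hat_mass_pos[OF i] i
    by (intro continuous_intros continuous_on_compose2[OF continuous_on_real_power[OF \<alpha>]]) auto
  have "AE s in lebesgue_on {0..T}. U' s (x i) = D i s"
    using weak
  proof eventually_elim
    case (elim s)
    have "\<psi> i \<in> Sh Kh" using nodal i by (simp add: nodal_basis_def)
    from bspec[OF elim this]
    have "U' s (x i) * surface_integral Kh (\<psi> i) + d * (\<Sum>j=1..N. stiffness i j * \<xi> j s)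
        = - \<beta> * (real_power (\<xi> i s) \<alpha> * surface_integral Kh (\<psi> i))"
      unfolding interpolant_times_hat[OF i] surface_integral_mult hat_expansion_at_vertex[OF i]
        dirichlet_form_hat[OF i] .
    then show ?case using hat_mass_pos[OF i] by (simp add: D_def field_simps)
  qed
  then show ?thesis
    by (rule has_real_derivative_of_AE_derivative[OF meas[OF i] D _ int[OF i] t])
qed

end

theorem theorem1:
  fixes \<Gamma> W :: "(real^3) set" and sd :: "real^3 \<Rightarrow> real" and a :: "real^3 \<Rightarrow> real^3"
    and h :: real and Kh :: "(real^3) set set" and N :: nat and x :: "nat \<Rightarrow> real^3"
    and \<psi> :: "nat \<Rightarrow> real^3 \<Rightarrow> real" and d \<beta> \<alpha> T :: real and \<xi> :: "nat \<Rightarrow> real \<Rightarrow> real"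
  assumes "triangulated_surface \<Gamma> W sd a h Kh N x"
    and "nodal_basis Kh N x \<psi>"
    and "angle_condition Kh"
    and "d > 0" and "\<beta> \<ge> 0" and "\<alpha> \<ge> 1" and "T > 0"
    and "semi_discrete_solution Kh N x \<psi> d \<beta> \<alpha> T (\<lambda>t y. \<Sum>i=1..N. \<xi> i t * \<psi> i y)"
    and "\<forall>i\<in>{1..N}. \<xi> i 0 \<ge> 0"
  shows "\<forall>i\<in>{1..N}. \<forall>t\<in>{0<..T}. 0 \<le> \<xi> i t \<and> \<xi> i t \<le> Max ((\<lambda>j. \<xi> j 0) ` {1..N})"
proof (intro ballI)
  interpret nodal_surface \<Gamma> W sd a h Kh N x \<psi>
    using assms(1,2) by (simp add: nodal_surface_def nodal_surface_axioms_def)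
  fix i t assume i: "i \<in> {1..N}" and t: "t \<in> {0<..T}"
  let ?m = "\<lambda>i. surface_integral Kh (\<psi> i)"
  show "0 \<le> \<xi> i t \<and> \<xi> i t \<le> Max ((\<lambda>j. \<xi> j 0) ` {1..N})"
  proof (rule reaction_diffusion_system_bounds[where \<xi> = \<xi> and m = ?m and A = stiffness and d = d and \<beta> = \<beta> and \<alpha> = \<alpha> and I = "{1..N}" and T = T and i = i and t = t
        and D = "\<lambda>i t. - d * (\<Sum>j=1..N. stiffness i j * \<xi> j t) / ?m i - \<beta> * real_power (\<xi> i t) \<alpha>"])
    show "(\<xi> i has_real_derivative
        - d * (\<Sum>j=1..N. stiffness i j * \<xi> j t) / ?m i - \<beta> * real_power (\<xi> i t) \<alpha>) (at t within {0..T})"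
      if "i \<in> {1..N}" "t \<in> {0..T}" for i t
      using nodal_values_solve_ode[OF assms(6,8) that] .
    show "?m i * (- d * (\<Sum>j=1..N. stiffness i j * \<xi> j t) / ?m i - \<beta> * real_power (\<xi> i t) \<alpha>)
        + d * (\<Sum>j=1..N. stiffness i j * \<xi> j t) = - \<beta> * (?m i * real_power (\<xi> i t) \<alpha>)"
      if "i \<in> {1..N}" for i t
      using hat_mass_pos[OF that] by (simp add: field_simps)
    show "stiffness i j \<le> 0" if "i \<in> {1..N}" "j \<in> {1..N}" "i \<noteq> j" for i j
      using stiffness_off_diagonal[OF assms(3) that] .
  qed (use assms hat_mass_pos stiffness_row_sum stiffness_psd i t in auto)
qed

end
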